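(* Suppose $X$ is an integral, $F$-finite, strongly $F$-regular scheme of characteristic $p>0$ and $\mathcal{D}$ is a strongly $F$-regular Cartier subalgebra on $X$. The multiplier ideal $\mathcal{J}(\mathcal{D}\cdot\mathfrak{a}_\star^t)$ is a coherent sheaf for every graded sequence of ideals $\mathfrak{a}_\star$ on $X$ and every $t\in[0,\infty)$.
   Context: Schemes are separated and noetherian; $X$ is $F$-finite if its Frobenius is finite. A graded sequence of ideals is a sequence $\mathfrak{a}_\star=\{\mathfrak{a}_m\}_{m\ge1}$ of nonzero ideals of $\mathcal{O}_X$ with $\mathfrak{a}_s\mathfrak{a}_t\subseteq\mathfrak{a}_{s+t}$. Let $L$ be the function field of $X$. For open $U\subseteq X$, $\mathrm{Val}_U$ is the set of real-valued valuations $v:L\to\mathbb{R}\cup\{+\infty\}$ centered on $U$ (the center $c_U(v)$ is the point $x\in U$ with $\mathcal{O}_{U,x}$ dominated by the valuation ring of $v$), and $\mathrm{Val}_U^*$ is $\mathrm{Val}_U$ minus the trivial valuation. A $p^{-e}$-linear map on $L$ is an additive $\psi:L\to L$ with $\psi(f^{p^e}g)=f\psi(g)$. $\mathcal{C}^X=\bigoplus_{e\ge0}\mathcal{C}^X_e$ is the sheaf of graded rings of $p^{-e}$-linear maps $\psi$ with $\psi(\mathcal{O}_X)\subseteq\mathcal{O}_X$ (over open subsets), with composition as product. A Cartier subalgebra is a quasi-coherent sheaf of graded subrings $\mathcal{D}=\bigoplus\mathcal{D}_e\subseteq\mathcal{C}^X$ with $\mathcal{D}_0=\mathcal{O}_X$.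 $\mathcal{D}$ is strongly $F$-regular if for every $x\in X$ and nonzero $f\in\mathcal{O}_{X,x}$ there are $e\ge1$ and $\psi\in(\mathcal{D}_e)_x$ with $\psi(f)=1$; $X$ is strongly $F$-regular if $\mathcal{C}^X$ is. For a nonzero $p^{-e}$-linear $\psi$, $e\ge1$, $0\neq f\in L$: $E(f,\psi,v)=\frac{v(f)-p^ev(\psi(f))}{p^e-1}$, $A(v;\psi)=\sup_{f\ne0,n\ge1}E(f,\psi^n,v)$, and $A(v;\mathcal{D})=\sup_{e\ge1}\sup_{0\ne\psi\in(\mathcal{D}_e)_{c_X(v)}}A(v;\psi)$. For an ideal $\mathfrak{a}$ and real $s\ge0$, $\mathcal{D}\cdot\mathfrak{a}^s$ is the Cartier subalgebra with degree-$e$ part consisting of finite sums of maps $g\mapsto\phi(ag)$, $\phi\in\mathcal{D}_e$, $a\in\mathfrak{a}^{\lceil s(p^e-1)\rceil}$. For $t\ge0$, $A(v;\mathcal{D}\cdot\mathfrak{a}_\star^t)=\sup_{m\ge1}A(v;\mathcal{D}\cdot\mathfrak{a}_m^{t/m})$. $\mathcal{J}(\mathcal{D}\cdot\mathfrak{a}_\star^t)$ is the sheaf with sections over an affine open $U=\mathrm{Spec}(R)\subseteq X$ equal to $\bigcap_{v\in\mathrm{Val}_U^*}\{f\in R: v(f)+A(v;\mathcal{D}\cdot\mathfrak{a}_\star^t)>0\}$. *)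

theory Defs
  imports
    "HOL-Analysis.Abstract_Topology"
    "HOL-Library.Extended_Real"
    "HOL-Algebra.Algebra"
    "HOL-Algebra.Algebraic_Closure_Type"
begin

text \<open>
  An integral scheme with function field \<open>L\<close> is represented by its topological space \<open>T\<close> and its
  structure sheaf, the latter embedded, as usual, in the constant sheaf \<open>L\<close>: for nonempty open
  \<open>U\<close>, the sections \<open>\<O> U\<close> are a subring of the field \<open>L\<close> (here the type \<open>'k\<close>), and restriction
  maps are inclusions.  All sheaves below are subsheaves of constant sheaves in this sense; their
  values on the empty set are irrelevant and left unconstrained.
\<close>

section \<open>Subsheaves of a constant sheaf on an irreducible space\<close>

definition nonempty_open :: "'a topology \<Rightarrow> 'a set \<Rightarrow> bool" where
  "nonempty_open T U \<longleftrightarrow> openin T U \<and> U \<noteq> {}"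

definition irreducible_space :: "'a topology \<Rightarrow> bool" where
  "irreducible_space T \<longleftrightarrow> topspace T \<noteq> {} \<and>
     (\<forall>U V. nonempty_open T U \<and> nonempty_open T V \<longrightarrow> U \<inter> V \<noteq> {})"

text \<open>
  On an irreducible space nonempty open sets meet, so a compatible family of sections is a constant
  family, and restriction and gluing together amount to the following equation.
\<close>

definition subsheaf_of_constant :: "'a topology \<Rightarrow> ('a set \<Rightarrow> 'm set) \<Rightarrow> bool" where
  "subsheaf_of_constant T F \<longleftrightarrow>
     (\<forall>\<U>. \<U> \<noteq> {} \<and> (\<forall>U\<in>\<U>. nonempty_open T U) \<longrightarrow> F (\<Union>\<U>) = (\<Inter>U\<in>\<U>. F U))"

definition stalk :: "'a topology \<Rightarrow> ('a set \<Rightarrow> 'm set) \<Rightarrow> 'a \<Rightarrow> 'm set" where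
  "stalk T F x = \<Union>{F U | U. openin T U \<and> x \<in> U}"

section \<open>Schemes\<close>

definition subring_of_type :: "'k::field set \<Rightarrow> 'k ring" where
  "subring_of_type S = ring_of_type_algebra\<lparr>carrier := S\<rparr>"

definition Spec :: "'k::field set \<Rightarrow> 'k set set" where
  "Spec R = {P. primeideal P (subring_of_type R)}"

definition zariski_topology :: "'k::field set \<Rightarrow> 'k set topology" where
  "zariski_topology R = topology (\<lambda>V. \<exists>S\<subseteq>R. V = {P \<in> Spec R. \<not> S \<subseteq> P})"

lemma openin_zariski_topology:
  "openin (zariski_topology R) V \<longleftrightarrow> (\<exists>S\<subseteq>R. V = {P \<in> Spec R. \<not> S \<subseteq> P})"
proof -
  have "istopology (\<lambda>V. \<exists>S\<subseteq>R. V = {P \<in> Spec R. \<not> S \<subseteq> P})"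
    unfolding istopology_def
  proof (intro conjI allI impI)
    fix V W
    assume "\<exists>S\<subseteq>R. V = {P \<in> Spec R. \<not> S \<subseteq> P}" "\<exists>T\<subseteq>R. W = {P \<in> Spec R. \<not> T \<subseteq> P}"
    then obtain S T where S: "S \<subseteq> R" "V = {P \<in> Spec R. \<not> S \<subseteq> P}"
      and T: "T \<subseteq> R" "W = {P \<in> Spec R. \<not> T \<subseteq> P}" by blast
    let ?M = "{s * t | s t. s \<in> S \<and> t \<in> T} \<inter> R"
    have "\<not> ?M \<subseteq> P \<longleftrightarrow> \<not> S \<subseteq> P \<and> \<not> T \<subseteq> P" if P: "P \<in> Spec R" for P
    proof -
      interpret primeideal P "subring_of_type R" using P by (simp add: Spec_def)
      have prime: "a \<in> P \<or> b \<in> P" if "a * b \<in> P" "a \<in> R" "b \<in> R" for a b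
        using I_prime[of a b] that by (simp add: subring_of_type_def ring_of_type_algebra_def)
      have l: "a * b \<in> P" if "b \<in> P" "a \<in> R" for a b
        using I_l_closed[of b a] that by (simp add: subring_of_type_def ring_of_type_algebra_def)
      have r: "a * b \<in> P" if "a \<in> P" "b \<in> R" for a b
        using I_r_closed[of a b] that by (simp add: subring_of_type_def ring_of_type_algebra_def)
      have m: "a * b \<in> R" if "a \<in> R" "b \<in> R" for a b
        using m_closed[of a b] that by (simp add: subring_of_type_def ring_of_type_algebra_def)
      show ?thesis
      proof
        assume "\<not> ?M \<subseteq> P"
        then obtain s t where "s \<in> S" "t \<in> T" "s * t \<notin> P" by auto
        moreover have "s \<in> R" "t \<in> R" using S(1) T(1) calculation by auto
        ultimately have "s \<notin> P" "t \<notin> P" using l r by auto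
        then show "\<not> S \<subseteq> P \<and> \<not> T \<subseteq> P" using \<open>s \<in> S\<close> \<open>t \<in> T\<close> by auto
      next
        assume "\<not> S \<subseteq> P \<and> \<not> T \<subseteq> P"
        then obtain s t where st: "s \<in> S" "t \<in> T" "s \<notin> P" "t \<notin> P" by auto
        then have "s \<in> R" "t \<in> R" using S(1) T(1) by auto
        then have "s * t \<notin> P" "s * t \<in> R" using prime m st by auto
        then show "\<not> ?M \<subseteq> P" using st by auto
      qed
    qed
    then have "V \<inter> W = {P \<in> Spec R. \<not> ?M \<subseteq> P}"
      unfolding S(2) T(2) by (simp only: set_eq_iff Int_iff mem_Collect_eq) iprover
    then show "\<exists>S\<subseteq>R. V \<inter> W = {P \<in> Spec R. \<not> S \<subseteq> P}" by (meson inf_le2)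
  next
    fix \<V> assume "\<forall>V\<in>\<V>. \<exists>S\<subseteq>R. V = {P \<in> Spec R. \<not> S \<subseteq> P}"
    then obtain S where S: "\<And>V. V \<in> \<V> \<Longrightarrow> S V \<subseteq> R \<and> V = {P \<in> Spec R. \<not> S V \<subseteq> P}" by metis
    show "\<exists>S\<subseteq>R. \<Union>\<V> = {P \<in> Spec R. \<not> S \<subseteq> P}"
    proof (intro exI[of _ "\<Union>V\<in>\<V>. S V"] conjI)
      have "P \<in> \<Union>\<V> \<longleftrightarrow> P \<in> Spec R \<and> \<not> (\<Union>V\<in>\<V>. S V) \<subseteq> P" for P
      proof -
        have "P \<in> V \<longleftrightarrow> P \<in> Spec R \<and> \<not> S V \<subseteq> P" if "V \<in> \<V>" for V
          using S[OF that] by (metis (mono_tags, lifting) mem_Collect_eq)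
        then show ?thesis unfolding UN_subset_iff by blast
      qed
      then show "\<Union>\<V> = {P \<in> Spec R. \<not> (\<Union>V\<in>\<V>. S V) \<subseteq> P}" by auto
      show "(\<Union>V\<in>\<V>. S V) \<subseteq> R" using S by (meson UN_least)
    qed
  qed
  then show ?thesis by (simp add: zariski_topology_def)
qed

definition max_ideal_at :: "'a topology \<Rightarrow> ('a set \<Rightarrow> 'k::field set) \<Rightarrow> 'a \<Rightarrow> 'k set" where
  "max_ideal_at T \<O> x = stalk T \<O> x - Units (subring_of_type (stalk T \<O> x))"

definition basic_open ::
  "'a topology \<Rightarrow> ('a set \<Rightarrow> 'k::field set) \<Rightarrow> 'a set \<Rightarrow> 'k \<Rightarrow> 'a set" where
  "basic_open T \<O> U f = {x \<in> U. f \<notin> max_ideal_at T \<O> x}"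

text \<open>
  \<open>U\<close> is affine if the canonical map from \<open>U\<close> to the spectrum of \<open>\<O> U\<close> is an isomorphism:
  a homeomorphism under which the sections over \<open>D(f)\<close> are the localization at \<open>f\<close>.
\<close>

definition affine_open :: "'a topology \<Rightarrow> ('a set \<Rightarrow> 'k::field set) \<Rightarrow> 'a set \<Rightarrow> bool" where
  "affine_open T \<O> U \<longleftrightarrow> nonempty_open T U \<and>
     homeomorphic_map (subtopology T U) (zariski_topology (\<O> U))
       (\<lambda>x. \<O> U \<inter> max_ideal_at T \<O> x) \<and>
     (\<forall>f\<in>\<O> U - {0}. \<O> (basic_open T \<O> U f) = {g / f ^ n | g n. g \<in> \<O> U})"

text \<open>
  The final clause says that \<open>L\<close> is the stalk at the generic point (which lies in every
  nonempty open set), i.e. that \<open>L\<close> is the function field.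
\<close>

definition integral_scheme :: "'a topology \<Rightarrow> ('a set \<Rightarrow> 'k::field set) \<Rightarrow> bool" where
  "integral_scheme T \<O> \<longleftrightarrow>
     irreducible_space T \<and>
     (\<forall>U. nonempty_open T U \<longrightarrow> subring (\<O> U) ring_of_type_algebra) \<and>
     subsheaf_of_constant T \<O> \<and>
     (\<forall>x\<in>topspace T. \<exists>U. affine_open T \<O> U \<and> x \<in> U) \<and>
     \<Union>{\<O> U | U. nonempty_open T U} = UNIV"

text \<open>
  The diagonal is a closed immersion.  This is checked on the open cover of the product by the
  products of affine open sets \<open>U\<close>, \<open>V\<close>: the inverse image of such a product under the diagonal is
  the intersection of \<open>U\<close> and \<open>V\<close>, so the condition is that this is affine and that the sections
  over it are the image of the tensor product of \<open>\<O> U\<close> and \<open>\<O> V\<close> over the integers, i.e. the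
  subring of \<open>L\<close> generated by both.
\<close>

definition separated_scheme :: "'a topology \<Rightarrow> ('a set \<Rightarrow> 'k::field set) \<Rightarrow> bool" where
  "separated_scheme T \<O> \<longleftrightarrow>
     (\<forall>U V. affine_open T \<O> U \<and> affine_open T \<O> V \<longrightarrow>
        affine_open T \<O> (U \<inter> V) \<and>
        \<O> (U \<inter> V) = generate_ring ring_of_type_algebra (\<O> U \<union> \<O> V))"

definition noetherian_scheme :: "'a topology \<Rightarrow> ('a set \<Rightarrow> 'k::field set) \<Rightarrow> bool" where
  "noetherian_scheme T \<O> \<longleftrightarrow>
     (\<exists>\<U>. finite \<U> \<and> \<Union>\<U> = topspace T \<and>
        (\<forall>U\<in>\<U>. affine_open T \<O> U \<and> noetherian_ring (subring_of_type (\<O> U))))"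

definition F_finite :: "nat \<Rightarrow> 'a topology \<Rightarrow> ('a set \<Rightarrow> 'k::field set) \<Rightarrow> bool" where
  "F_finite p T \<O> \<longleftrightarrow>
     (\<forall>U. affine_open T \<O> U \<longrightarrow>
        (\<exists>B. finite B \<and> B \<subseteq> \<O> U \<and>
           (\<forall>f\<in>\<O> U. \<exists>c. (\<forall>b\<in>B. c b \<in> \<O> U) \<and> f = (\<Sum>b\<in>B. c b ^ p * b))))"

section \<open>Quasi-coherent sheaves and ideal sheaves\<close>

text \<open>
  Quasi-coherence of a subsheaf of \<open>\<O>\<close>-submodules of a constant \<open>L\<close>-vector space whose scalar
  multiplication is \<open>scale\<close>: over an affine open \<open>U\<close>, the sections over \<open>D(f)\<close> are the localization
  at \<open>f\<close> of the sections over \<open>U\<close>.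
\<close>

definition quasi_coherent ::
  "'a topology \<Rightarrow> ('a set \<Rightarrow> 'k::field set) \<Rightarrow> ('k \<Rightarrow> 'm \<Rightarrow> 'm) \<Rightarrow> ('a set \<Rightarrow> 'm set) \<Rightarrow> bool" where
  "quasi_coherent T \<O> scale F \<longleftrightarrow>
     (\<forall>U f. affine_open T \<O> U \<and> f \<in> \<O> U - {0} \<longrightarrow>
        F (basic_open T \<O> U f) = {scale (inverse (f ^ n)) s | s n. s \<in> F U})"

definition ideal_sheaf ::
  "'a topology \<Rightarrow> ('a set \<Rightarrow> 'k::field set) \<Rightarrow> ('a set \<Rightarrow> 'k set) \<Rightarrow> bool" where
  "ideal_sheaf T \<O> I \<longleftrightarrow>
     (\<forall>U. nonempty_open T U \<longrightarrow> ideal (I U) (subring_of_type (\<O> U))) \<and>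
     subsheaf_of_constant T I"

definition coherent_ideal_sheaf ::
  "'a topology \<Rightarrow> ('a set \<Rightarrow> 'k::field set) \<Rightarrow> ('a set \<Rightarrow> 'k set) \<Rightarrow> bool" where
  "coherent_ideal_sheaf T \<O> I \<longleftrightarrow>
     ideal_sheaf T \<O> I \<and>
     quasi_coherent T \<O> (*) I \<and>
     (\<forall>U. affine_open T \<O> U \<longrightarrow>
        (\<exists>S. finite S \<and> S \<subseteq> I U \<and> I U = genideal (subring_of_type (\<O> U)) S))"

definition graded_sequence_of_ideals ::
  "'a topology \<Rightarrow> ('a set \<Rightarrow> 'k::field set) \<Rightarrow> (nat \<Rightarrow> 'a set \<Rightarrow> 'k set) \<Rightarrow> bool" where
  "graded_sequence_of_ideals T \<O> \<aa> \<longleftrightarrow>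
     (\<forall>m\<ge>1. coherent_ideal_sheaf T \<O> (\<aa> m) \<and>
        (\<exists>U. nonempty_open T U \<and> \<not> \<aa> m U \<subseteq> {0})) \<and>
     (\<forall>r\<ge>1. \<forall>s\<ge>1. \<forall>U. nonempty_open T U \<longrightarrow>
        (\<forall>f\<in>\<aa> r U. \<forall>g\<in>\<aa> s U. f * g \<in> \<aa> (r + s) U))"

section \<open>Cartier subalgebras\<close>

definition p_inv_linear :: "nat \<Rightarrow> nat \<Rightarrow> ('k::field \<Rightarrow> 'k) \<Rightarrow> bool" where
  "p_inv_linear p e \<psi> \<longleftrightarrow>
     (\<forall>f g. \<psi> (f + g) = \<psi> f + \<psi> g) \<and> (\<forall>f g. \<psi> (f ^ (p ^ e) * g) = f * \<psi> g)"

text \<open>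
  A graded subsheaf of \<open>\<C>\<^sup>X\<close> is given by its homogeneous parts; \<open>\<D> e U\<close> are the
  sections of degree \<open>e\<close> over \<open>U\<close>.
\<close>

definition cartier_algebra ::
  "nat \<Rightarrow> 'a topology \<Rightarrow> ('a set \<Rightarrow> 'k::field set) \<Rightarrow> nat \<Rightarrow> 'a set \<Rightarrow> ('k \<Rightarrow> 'k) set" where
  "cartier_algebra p T \<O> e U =
     {\<psi>. p_inv_linear p e \<psi> \<and> (\<forall>V. nonempty_open T V \<and> V \<subseteq> U \<longrightarrow> \<psi> ` \<O> V \<subseteq> \<O> V)}"

definition cartier_subalgebra ::
  "nat \<Rightarrow> 'a topology \<Rightarrow> ('a set \<Rightarrow> 'k::field set) \<Rightarrow> (nat \<Rightarrow> 'a set \<Rightarrow> ('k \<Rightarrow> 'k) set) \<Rightarrow> bool" where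
  "cartier_subalgebra p T \<O> \<D> \<longleftrightarrow>
     (\<forall>e U. nonempty_open T U \<longrightarrow>
        \<D> e U \<subseteq> cartier_algebra p T \<O> e U \<and>
        (\<lambda>_. 0) \<in> \<D> e U \<and>
        (\<forall>\<phi>\<in>\<D> e U. \<forall>\<psi>\<in>\<D> e U. (\<lambda>g. \<phi> g - \<psi> g) \<in> \<D> e U)) \<and>
     (\<forall>e d U. nonempty_open T U \<longrightarrow>
        (\<forall>\<phi>\<in>\<D> e U. \<forall>\<psi>\<in>\<D> d U. \<phi> \<circ> \<psi> \<in> \<D> (e + d) U)) \<and>
     (\<forall>U. nonempty_open T U \<longrightarrow> \<D> 0 U = (\<lambda>f g. f * g) ` \<O> U) \<and>
     (\<forall>e. subsheaf_of_constant T (\<D> e) \<and> quasi_coherent T \<O> (\<lambda>c \<psi> g. c * \<psi> g) (\<D> e))"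

definition strongly_F_regular ::
  "'a topology \<Rightarrow> ('a set \<Rightarrow> 'k::field set) \<Rightarrow> (nat \<Rightarrow> 'a set \<Rightarrow> ('k \<Rightarrow> 'k) set) \<Rightarrow> bool" where
  "strongly_F_regular T \<O> \<D> \<longleftrightarrow>
     (\<forall>x\<in>topspace T. \<forall>f\<in>stalk T \<O> x - {0}. \<exists>e\<ge>1. \<exists>\<psi>\<in>stalk T (\<D> e) x. \<psi> f = 1)"

text \<open>
  The sheaf generated by the finite sums of maps \<open>g \<mapsto> \<phi> (a * g)\<close>: its sections are the
  maps that are locally of this form.  The power of the ideal \<open>\<aa> V\<close> is taken in the library's monoid
  of ideals of the ring \<open>\<O> V\<close>; its zeroth power is \<open>\<O> V\<close>.
\<close>

definition twisted_cartier_subalgebra ::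
  "nat \<Rightarrow> 'a topology \<Rightarrow> ('a set \<Rightarrow> 'k::field set) \<Rightarrow> (nat \<Rightarrow> 'a set \<Rightarrow> ('k \<Rightarrow> 'k) set) \<Rightarrow>
     ('a set \<Rightarrow> 'k set) \<Rightarrow> real \<Rightarrow> nat \<Rightarrow> 'a set \<Rightarrow> ('k \<Rightarrow> 'k) set" where
  "twisted_cartier_subalgebra p T \<O> \<D> \<aa> s e U =
     {\<psi>. \<forall>x\<in>U. \<exists>V. openin T V \<and> x \<in> V \<and> V \<subseteq> U \<and>
        (\<exists>(n::nat) \<phi> a. (\<forall>i<n. \<phi> i \<in> \<D> e V \<and>
              a i \<in> \<aa> V [^]\<^bsub>ideals_set (subring_of_type (\<O> V))\<^esub> nat \<lceil>s * (real p ^ e - 1)\<rceil>) \<and>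
           \<psi> = (\<lambda>g. \<Sum>i<n. \<phi> i (a i * g)))}"

section \<open>Valuations and log discrepancies\<close>

definition is_valuation :: "('k::field \<Rightarrow> ereal) \<Rightarrow> bool" where
  "is_valuation v \<longleftrightarrow>
     v 0 = \<infinity> \<and> (\<forall>f. f \<noteq> 0 \<longrightarrow> \<bar>v f\<bar> \<noteq> \<infinity>) \<and>
     (\<forall>f g. v (f * g) = v f + v g) \<and> (\<forall>f g. v (f + g) \<ge> min (v f) (v g))"

definition trivial_valuation :: "'k::field \<Rightarrow> ereal" where
  "trivial_valuation f = (if f = 0 then \<infinity> else 0)"

definition centered_at ::
  "'a topology \<Rightarrow> ('a set \<Rightarrow> 'k::field set) \<Rightarrow> ('k \<Rightarrow> ereal) \<Rightarrow> 'a \<Rightarrow> bool" where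
  "centered_at T \<O> v x \<longleftrightarrow> x \<in> topspace T \<and>
     stalk T \<O> x \<subseteq> {f. v f \<ge> 0} \<and> max_ideal_at T \<O> x = stalk T \<O> x \<inter> {f. v f > 0}"

definition center_of ::
  "'a topology \<Rightarrow> ('a set \<Rightarrow> 'k::field set) \<Rightarrow> ('k \<Rightarrow> ereal) \<Rightarrow> 'a" where
  "center_of T \<O> v = (THE x. centered_at T \<O> v x)"

definition Val ::
  "'a topology \<Rightarrow> ('a set \<Rightarrow> 'k::field set) \<Rightarrow> 'a set \<Rightarrow> ('k \<Rightarrow> ereal) set" where
  "Val T \<O> U = {v. is_valuation v \<and> (\<exists>x\<in>U. centered_at T \<O> v x)}"

definition Val_star ::
  "'a topology \<Rightarrow> ('a set \<Rightarrow> 'k::field set) \<Rightarrow> 'a set \<Rightarrow> ('k \<Rightarrow> ereal) set" where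
  "Val_star T \<O> U = Val T \<O> U - {trivial_valuation}"

text \<open>
  In the next two definitions \<open>e\<close> is the degree of \<open>\<psi>\<close>; it is an explicit argument because a map
  on a finite field can be \<open>p\<^sup>-\<^sup>e\<close>-linear for several \<open>e\<close>.  If \<open>\<psi> f = 0\<close>, the first
  quotient is \<open>-\<infinity>\<close>.
\<close>

definition E_quot :: "nat \<Rightarrow> nat \<Rightarrow> 'k::field \<Rightarrow> ('k \<Rightarrow> 'k) \<Rightarrow> ('k \<Rightarrow> ereal) \<Rightarrow> ereal" where
  "E_quot p e f \<psi> v = (v f - ereal (real p ^ e) * v (\<psi> f)) / ereal (real p ^ e - 1)"

definition log_discrepancy_map ::
  "nat \<Rightarrow> nat \<Rightarrow> ('k::field \<Rightarrow> ereal) \<Rightarrow> ('k \<Rightarrow> 'k) \<Rightarrow> ereal" where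
  "log_discrepancy_map p e v \<psi> = (SUP f\<in>-{0}. SUP n\<in>{1..}. E_quot p (e * n) f (\<psi> ^^ n) v)"

definition log_discrepancy ::
  "nat \<Rightarrow> 'a topology \<Rightarrow> ('a set \<Rightarrow> 'k::field set) \<Rightarrow> ('k \<Rightarrow> ereal) \<Rightarrow>
     (nat \<Rightarrow> 'a set \<Rightarrow> ('k \<Rightarrow> 'k) set) \<Rightarrow> ereal" where
  "log_discrepancy p T \<O> v \<D> =
     (SUP e\<in>{1..}. SUP \<psi>\<in>stalk T (\<D> e) (center_of T \<O> v) - {\<lambda>_. 0}. log_discrepancy_map p e v \<psi>)"

definition log_discrepancy_graded ::
  "nat \<Rightarrow> 'a topology \<Rightarrow> ('a set \<Rightarrow> 'k::field set) \<Rightarrow> ('k \<Rightarrow> ereal) \<Rightarrow>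
     (nat \<Rightarrow> 'a set \<Rightarrow> ('k \<Rightarrow> 'k) set) \<Rightarrow> (nat \<Rightarrow> 'a set \<Rightarrow> 'k set) \<Rightarrow> real \<Rightarrow> ereal" where
  "log_discrepancy_graded p T \<O> v \<D> \<aa> t =
     (SUP m\<in>{1..}. log_discrepancy p T \<O> v
        (twisted_cartier_subalgebra p T \<O> \<D> (\<aa> m) (t / real m)))"

text \<open>
  The defining formula on affine open sets is used on all nonempty open sets.  Since the valuations
  centered on a union are those centered on one of its members, this is the unique sheaf with the
  prescribed sections over affine open sets.
\<close>

definition multiplier_ideal ::
  "nat \<Rightarrow> 'a topology \<Rightarrow> ('a set \<Rightarrow> 'k::field set) \<Rightarrow> (nat \<Rightarrow> 'a set \<Rightarrow> ('k \<Rightarrow> 'k) set) \<Rightarrow>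
     (nat \<Rightarrow> 'a set \<Rightarrow> 'k set) \<Rightarrow> real \<Rightarrow> 'a set \<Rightarrow> 'k set" where
  "multiplier_ideal p T \<O> \<D> \<aa> t U =
     {f \<in> \<O> U. \<forall>v\<in>Val_star T \<O> U. v f + log_discrepancy_graded p T \<O> v \<D> \<aa> t > 0}"

end

theory Submission
  imports Defs "HOL-Analysis.Function_Topology" "HOL-Analysis.Extended_Real_Limits"
begin

text \<open>
  Everything except quasi-coherence of \<open>\<J>\<close> is formal once affine rings of a noetherian scheme are
  known to be noetherian.  For quasi-coherence, let \<open>U\<close> be affine and let \<open>g\<close> be a section over \<open>U\<close>
  that lies in \<open>\<J>(D(f))\<close>, but suppose that \<open>f\<^sup>n g\<close> is never in \<open>\<J>(U)\<close>.  There are then valuations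
  \<open>v\<^sub>n\<close> centered on \<open>U\<close> with \<open>v\<^sub>n(f\<^sup>n g) + A(v\<^sub>n) \<le> 0\<close>.  Choose a nonzero \<open>c \<in> \<aa>\<^sub>1(U)\<close>, normalize by
  \<open>v\<^sub>n(c f) = 1\<close>, and pass to a pointwise cluster limit \<open>w\<close> with values in the extended reals.
  The elements with positive \<open>w\<close> form a prime ideal of \<open>\<O>(U)\<close>, i.e. a point \<open>x\<close>.  Strong
  \<open>F\<close>-regularity at \<open>x\<close> supplies, for each \<open>h \<noteq> 0\<close>, a map \<open>\<phi>\<close> with \<open>\<phi>(h)\<close> a unit at \<open>x\<close>; twisted by
  a power of \<open>c\<close>, it bounds \<open>A(v\<^sub>n)\<close> from below and yields a bound on \<open>n v\<^sub>n(f) + v\<^sub>n(h)\<close>.  Hence \<open>w\<close>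
  is finite on nonzero elements and \<open>w(f) = 0\<close>, so \<open>w\<close> is a nontrivial valuation centered on \<open>D(f)\<close>.
  Since \<open>A\<close> is a supremum of functions continuous in the valuation, \<open>w(g) + A(w) > 0\<close>
  contradicts the choice of the \<open>v\<^sub>n\<close>.
\<close>

section \<open>Subrings of a field and their ideals\<close>

lemma subring_of_type_simps [simp]:
  "carrier (subring_of_type R) = R"
  "monoid.mult (subring_of_type R) = (*)"
  "monoid.one (subring_of_type R) = 1"
  "ring.add (subring_of_type R) = (+)"
  "ring.zero (subring_of_type R) = 0"
  by (simp_all add: subring_of_type_def ring_of_type_algebra_def)

definition is_subring :: "'k::field set \<Rightarrow> bool" where
  "is_subring R \<longleftrightarrow> subring R ring_of_type_algebra"

lemma is_subringD:
  assumes "is_subring R"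
  shows "0 \<in> R" "1 \<in> R"
    and "\<And>x y. x \<in> R \<Longrightarrow> y \<in> R \<Longrightarrow> x + y \<in> R"
    and "\<And>x y. x \<in> R \<Longrightarrow> y \<in> R \<Longrightarrow> x * y \<in> R"
    and "\<And>x. x \<in> R \<Longrightarrow> - x \<in> R"
    and "\<And>x n. x \<in> R \<Longrightarrow> x ^ n \<in> R"
proof -
  interpret K: cring "ring_of_type_algebra :: 'a ring" by blast
  have [simp]: "carrier (ring_of_type_algebra :: 'a ring) = UNIV"
    "monoid.mult (ring_of_type_algebra :: 'a ring) = (*)" "monoid.one (ring_of_type_algebra :: 'a ring) = 1"
    "ring.add (ring_of_type_algebra :: 'a ring) = (+)" "ring.zero (ring_of_type_algebra :: 'a ring) = 0"
    by (simp_all add: ring_of_type_algebra_def)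
  have "subring R (ring_of_type_algebra :: 'a ring)" using assms by (simp add: is_subring_def)
  note S = subringE[OF this]
  show "0 \<in> R" using S(2) by simp
  show one: "1 \<in> R" using S(3) by simp
  show "x + y \<in> R" if "x \<in> R" "y \<in> R" for x y using S(7)[of x y] that by simp
  show mult: "x * y \<in> R" if "x \<in> R" "y \<in> R" for x y using S(6)[of x y] that by simp
  show "- x \<in> R" if "x \<in> R" for x
  proof -
    have "a_inv ring_of_type_algebra x = - x"
      by (rule K.minus_equality) auto
    then show ?thesis using S(5)[OF that] by simp
  qed
  show "x ^ n \<in> R" if "x \<in> R" for x n by (induction n) (auto intro: one mult that)
qed

lemma is_subringI:
  assumes "1 \<in> R" "\<And>x. x \<in> R \<Longrightarrow> - x \<in> R"
    "\<And>x y. x \<in> R \<Longrightarrow> y \<in> R \<Longrightarrow> x + y \<in> R" "\<And>x y. x \<in> R \<Longrightarrow> y \<in> R \<Longrightarrow> x * y \<in> R"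
  shows "is_subring (R :: 'k::field set)"
proof -
  interpret K: cring "ring_of_type_algebra :: 'k ring" by blast
  have [simp]: "carrier (ring_of_type_algebra :: 'k ring) = UNIV"
    "monoid.mult (ring_of_type_algebra :: 'k ring) = (*)"
    "monoid.one (ring_of_type_algebra :: 'k ring) = 1"
    "ring.add (ring_of_type_algebra :: 'k ring) = (+)"
    "ring.zero (ring_of_type_algebra :: 'k ring) = 0"
    by (simp_all add: ring_of_type_algebra_def)
  have [simp]: "a_inv ring_of_type_algebra x = - x" for x :: 'k
    by (rule K.minus_equality) auto
  show ?thesis unfolding is_subring_def by (rule K.subringI) (use assms in auto)
qed

lemma cring_subring_of_type:
  assumes "is_subring R"
  shows "cring (subring_of_type R)"
proof -
  note R = is_subringD[OF assms]
  show ?thesis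
  proof (rule cringI)
    show "abelian_group (subring_of_type R)"
      by (rule abelian_groupI) (use R in \<open>auto simp: algebra_simps intro: bexI[of _ "- _"]\<close>)
    show "Group.comm_monoid (subring_of_type R)"
      by (rule comm_monoidI) (use R in \<open>auto simp: algebra_simps\<close>)
  qed (auto simp: algebra_simps)
qed

lemma ideal_subring_iff:
  assumes "is_subring R"
  shows "ideal I (subring_of_type R) \<longleftrightarrow>
    I \<subseteq> R \<and> 0 \<in> I \<and> (\<forall>x\<in>I. \<forall>y\<in>I. x + y \<in> I) \<and> (\<forall>x\<in>I. \<forall>r\<in>R. r * x \<in> I)"
    (is "_ \<longleftrightarrow> ?rhs")
proof
  assume "ideal I (subring_of_type R)"
  then interpret ideal I "subring_of_type R" .
  show ?rhs
    using a_subset additive_subgroup.zero_closed[OF additive_subgroup_axioms]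
      additive_subgroup.a_closed[OF additive_subgroup_axioms] I_l_closed by auto
next
  note R = is_subringD[OF assms]
  assume I: ?rhs
  interpret cring "subring_of_type R" by (rule cring_subring_of_type[OF assms])
  have minus: "a_inv (subring_of_type R) x = - x" if "x \<in> R" for x
    by (rule minus_equality) (use that R in auto)
  have neg: "- x \<in> I" if "x \<in> I" for x
  proof -
    have "(-1) * x \<in> I" using I R(2,5) that by blast
    then show ?thesis by simp
  qed
  have "subgroup I (add_monoid (subring_of_type R))"
  proof unfold_locales
    show "inv\<^bsub>add_monoid (subring_of_type R)\<^esub> x \<in> I" if "x \<in> I" for x
      unfolding a_inv_def[symmetric] using that I neg minus by auto
  qed (use I in auto)
  then show "ideal I (subring_of_type R)"
    by (intro idealI ring_axioms) (use I in \<open>auto simp: mult.commute\<close>)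
qed

lemma primeideal_subring_iff:
  assumes "is_subring R"
  shows "primeideal P (subring_of_type R) \<longleftrightarrow>
    ideal P (subring_of_type R) \<and> P \<noteq> R \<and> (\<forall>x\<in>R. \<forall>y\<in>R. x * y \<in> P \<longrightarrow> x \<in> P \<or> y \<in> P)"
    (is "_ \<longleftrightarrow> ?rhs")
proof
  assume "primeideal P (subring_of_type R)"
  then interpret primeideal P "subring_of_type R" .
  show ?rhs using is_ideal I_notcarr I_prime by auto
next
  interpret cring "subring_of_type R" by (rule cring_subring_of_type[OF assms])
  assume ?rhs
  then show "primeideal P (subring_of_type R)"
    by (intro primeidealI is_cring) auto
qed

text \<open>Zorn's lemma among the ideals that contain \<open>Q\<close> and avoid 1, since avoiding
  1 passes to unions of chains. It is used in contrapositive form: an ideal contained in no prime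
  ideal contains 1.\<close>

lemma primeideal_existence:
  assumes R: "is_subring R" and Q: "ideal Q (subring_of_type R)" and "1 \<notin> Q"
  shows "\<exists>P. primeideal P (subring_of_type R) \<and> Q \<subseteq> P"
proof -
  interpret cring "subring_of_type R" by (rule cring_subring_of_type[OF R])
  note id = ideal_subring_iff[OF R]
  define \<I> where "\<I> = {I. ideal I (subring_of_type R) \<and> Q \<subseteq> I \<and> 1 \<notin> I}"
  have ne: "\<I> \<noteq> {}" using Q \<open>1 \<notin> Q\<close> by (auto simp: \<I>_def)
  have "\<Union>\<C> \<in> \<I>" if "\<C> \<noteq> {}" and C: "subset.chain \<I> \<C>" for \<C>
  proof -
    have sub: "I \<in> \<I>" if "I \<in> \<C>" for I using C that by (auto simp: subset.chain_def)
    have "x + y \<in> \<Union>\<C>" if "x \<in> I" "I \<in> \<C>" "y \<in> J" "J \<in> \<C>" for x y I J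
    proof -
      have "I \<subseteq> J \<or> J \<subseteq> I" using C that by (auto simp: subset.chain_def)
      then obtain K where "K \<in> \<C>" "I \<subseteq> K" "J \<subseteq> K"
        using \<open>I \<in> \<C>\<close> \<open>J \<in> \<C>\<close> by (metis order_refl)
      then have "K \<in> \<C>" "x \<in> K" "y \<in> K" using \<open>x \<in> I\<close> \<open>y \<in> J\<close> by auto
      then have "x + y \<in> K" using sub[of K] by (simp add: \<I>_def id)
      then show ?thesis using \<open>K \<in> \<C>\<close> by blast
    qed
    moreover have "\<Union>\<C> \<subseteq> R" "\<And>x r. x \<in> \<Union>\<C> \<Longrightarrow> r \<in> R \<Longrightarrow> r * x \<in> \<Union>\<C>"
      using sub unfolding \<I>_def id by blast+
    moreover have "0 \<in> \<Union>\<C>"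
      using sub \<open>\<C> \<noteq> {}\<close> unfolding \<I>_def id by blast
    ultimately have "ideal (\<Union>\<C>) (subring_of_type R)"
      unfolding id by blast
    then show ?thesis using sub \<open>\<C> \<noteq> {}\<close> by (auto simp: \<I>_def)
  qed
  then have "\<exists>M\<in>\<I>. \<forall>N\<in>\<I>. M \<subseteq> N \<longrightarrow> N = M" using subset_Zorn_nonempty[OF ne] by simp
  then obtain M where M: "M \<in> \<I>" and max: "\<And>N. N \<in> \<I> \<Longrightarrow> M \<subseteq> N \<Longrightarrow> N = M" by blast
  have "maximalideal M (subring_of_type R)"
  proof (rule maximalidealI)
    show "ideal M (subring_of_type R)" using M by (simp add: \<I>_def)
    show "carrier (subring_of_type R) \<noteq> M" using M is_subringD(2)[OF R] by (auto simp: \<I>_def)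
    fix J assume J: "ideal J (subring_of_type R)" "M \<subseteq> J" "J \<subseteq> carrier (subring_of_type R)"
    show "J = M \<or> J = carrier (subring_of_type R)"
    proof (cases "1 \<in> J")
      case True
      then have "r * 1 \<in> J" if "r \<in> R" for r using J(1) that unfolding id by blast
      then have "R \<subseteq> J" by auto
      then show ?thesis using J(3) by auto
    next
      case False
      then show ?thesis using max[of J] J M by (auto simp: \<I>_def)
    qed
  qed
  then show ?thesis using maximalideal_prime M by (auto simp: \<I>_def)
qed

section \<open>Powers of ideals and their behaviour under localization\<close>

lemma ideal_pow_simps:
  "monoid.one (ideals_set (subring_of_type R)) = R"
  "monoid.mult (ideals_set (subring_of_type R)) = ideal_prod (subring_of_type R)"
  by (simp_all add: ideals_set_def)

lemma ideal_pow_ideal: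
  assumes "is_subring R" "ideal I (subring_of_type R)"
  shows "ideal (I [^]\<^bsub>ideals_set (subring_of_type R)\<^esub> (n::nat)) (subring_of_type R)"
proof -
  interpret cring "subring_of_type R" by (rule cring_subring_of_type) fact
  show ?thesis
    by (induction n) (use oneideal in \<open>auto simp: ideal_pow_simps intro: ideal_prod_is_ideal assms\<close>)
qed

lemma power_mem_ideal_pow:
  assumes "is_subring R" "c \<in> I"
  shows "c ^ n \<in> I [^]\<^bsub>ideals_set (subring_of_type R)\<^esub> (n::nat)"
proof (induction n)
  case (Suc n)
  have "c ^ n * c \<in> ideal_prod (subring_of_type R) (I [^]\<^bsub>ideals_set (subring_of_type R)\<^esub> n) I"
    using ideal_prod.prod[OF Suc assms(2), of "subring_of_type R"] by simp
  then show ?case by (simp add: ideal_pow_simps mult.commute)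
qed (use is_subringD[OF assms(1)] in \<open>simp add: ideal_pow_simps\<close>)

text \<open>Ring and ideal grow together, as they do under restriction to a smaller open
  set.\<close>

lemma ideal_pow_mono:
  assumes "R \<subseteq> R'" "I \<subseteq> I'"
  shows "I [^]\<^bsub>ideals_set (subring_of_type R)\<^esub> (n::nat) \<subseteq>
    I' [^]\<^bsub>ideals_set (subring_of_type R')\<^esub> n"
proof (induction n)
  case (Suc n)
  have "x \<in> ideal_prod (subring_of_type R') (I' [^]\<^bsub>ideals_set (subring_of_type R')\<^esub> n) I'"
    if "x \<in> ideal_prod (subring_of_type R) (I [^]\<^bsub>ideals_set (subring_of_type R)\<^esub> n) I" for x
    using that
  proof induction
    case (prod i j)
    then show ?case
      using ideal_prod.prod[of i _ j I' "subring_of_type R'"] Suc assms by auto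
  next
    case (sum s1 s2)
    then show ?case using ideal_prod.sum[of s1 "subring_of_type R'"] by auto
  qed
  then show ?case by (auto simp: ideal_pow_simps)
qed (use assms in \<open>simp add: ideal_pow_simps\<close>)

text \<open>An element of the power is a finite sum of products, so the finitely many denominators
  combine into a single power of \<open>q\<close>. In the application \<open>R'\<close> and
  \<open>I'\<close> are the sections over a basic open set \<open>D q\<close>.\<close>

lemma ideal_pow_clear_denominators:
  assumes R: "is_subring R" and I: "ideal I (subring_of_type R)" and q: "q \<in> R"
    and R': "\<And>x. x \<in> R' \<Longrightarrow> \<exists>N. q ^ N * x \<in> R"
    and I': "\<And>x. x \<in> I' \<Longrightarrow> \<exists>N. q ^ N * x \<in> I"
    and a: "a \<in> I' [^]\<^bsub>ideals_set (subring_of_type R')\<^esub> (n::nat)"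
  shows "\<exists>N. q ^ N * a \<in> I [^]\<^bsub>ideals_set (subring_of_type R)\<^esub> n"
  using a
proof (induction n arbitrary: a)
  case 0
  then show ?case using R' by (simp add: ideal_pow_simps)
next
  case (Suc n)
  let ?J = "\<lambda>m. I [^]\<^bsub>ideals_set (subring_of_type R)\<^esub> m"
  have "a \<in> ideal_prod (subring_of_type R') (I' [^]\<^bsub>ideals_set (subring_of_type R')\<^esub> n) I'"
    using Suc.prems by (simp add: ideal_pow_simps)
  then show ?case
  proof induction
    case (prod i j)
    from Suc.IH[OF prod(1)] obtain M where M: "q ^ M * i \<in> ?J n" by blast
    from I'[OF prod(2)] obtain N where N: "q ^ N * j \<in> I" by blast
    have "(q ^ M * i) * (q ^ N * j) \<in> ?J (Suc n)"
      using ideal_prod.prod[OF M N, of "subring_of_type R"] by (simp add: ideal_pow_simps)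
    then have "q ^ (M + N) * (i * j) \<in> ?J (Suc n)" by (simp add: power_add algebra_simps)
    then show ?case by auto
  next
    case (sum s1 s2)
    then obtain M N where M: "q ^ M * s1 \<in> ?J (Suc n)" and N: "q ^ N * s2 \<in> ?J (Suc n)" by blast
    have J: "ideal (?J (Suc n)) (subring_of_type R)" by (rule ideal_pow_ideal[OF R I])
    have "q ^ N * (q ^ M * s1) + q ^ M * (q ^ N * s2) \<in> ?J (Suc n)"
      using J M N is_subringD(6)[OF R q] unfolding ideal_subring_iff[OF R] by blast
    then have "q ^ (M + N) * (s1 + s2) \<in> ?J (Suc n)" by (simp add: power_add algebra_simps)
    then show ?case by auto
  qed
qed

section \<open>Real-valued valuations\<close>

lemma is_valuationD:
  assumes "is_valuation v"
  shows "v 0 = \<infinity>" "\<And>f. f \<noteq> 0 \<Longrightarrow> \<bar>v f\<bar> \<noteq> \<infinity>" "\<And>f g. v (f * g) = v f + v g"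
    "\<And>f g. min (v f) (v g) \<le> v (f + g)"
  using assms by (auto simp: is_valuation_def)

lemma valuation_one: "is_valuation v \<Longrightarrow> v 1 = 0"
  using is_valuationD(2,3)[of v 1] is_valuationD(3)[of v 1 1] by (cases "v 1") auto

lemma valuation_inverse: "is_valuation v \<Longrightarrow> x \<noteq> 0 \<Longrightarrow> v (inverse x) = - v x"
  using is_valuationD(2)[of v x] is_valuationD(2)[of v "inverse x"] is_valuationD(3)[of v x "inverse x"]
    valuation_one[of v] by (cases "v x"; cases "v (inverse x)") auto

lemma valuation_divide: "is_valuation v \<Longrightarrow> y \<noteq> 0 \<Longrightarrow> v (x / y) = v x - v y"
  using is_valuationD(3)[of v x "inverse y"] valuation_inverse[of v y]
  by (simp add: divide_inverse minus_ereal_def)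

section \<open>Integral schemes\<close>

lemma nonempty_open_Int:
  "irreducible_space T \<Longrightarrow> nonempty_open T U \<Longrightarrow> nonempty_open T V \<Longrightarrow> nonempty_open T (U \<inter> V)"
  by (auto simp: irreducible_space_def nonempty_open_def)

text \<open>The sheaf equation for the cover of \<open>U\<close> by \<open>U\<close> and
  \<open>V\<close>, which turns restriction into an inclusion.\<close>

lemma subsheaf_mono:
  assumes "subsheaf_of_constant T F" "nonempty_open T U" "nonempty_open T V" "V \<subseteq> U"
  shows "F U \<subseteq> F V"
proof -
  have "F (\<Union>{U, V}) = (\<Inter>W\<in>{U, V}. F W)"
    using assms unfolding subsheaf_of_constant_def by (metis empty_iff insert_iff)
  moreover have "\<Union>{U, V} = U" using assms(4) by auto
  ultimately show ?thesis by auto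
qed

lemma stalkI: "openin T V \<Longrightarrow> x \<in> V \<Longrightarrow> s \<in> F V \<Longrightarrow> s \<in> stalk T F x"
  by (auto simp: stalk_def)

locale int_scheme =
  fixes T :: "'a topology" and \<O> :: "'a set \<Rightarrow> 'k::field set"
  assumes integral: "integral_scheme T \<O>"
begin

lemma irreducible: "irreducible_space T"
  and sheaf: "subsheaf_of_constant T \<O>"
  using integral by (simp_all add: integral_scheme_def)

lemma sections_subring: "nonempty_open T U \<Longrightarrow> is_subring (\<O> U)"
  using integral by (simp add: integral_scheme_def is_subring_def)

lemma stalk_subring:
  assumes "x \<in> topspace T"
  shows "is_subring (stalk T \<O> x)"
proof (rule is_subringI)
  have ne: "nonempty_open T U" if "openin T U" "x \<in> U" for U
    using that by (auto simp: nonempty_open_def)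
  show "1 \<in> stalk T \<O> x"
    using stalkI[of T "topspace T" x 1 \<O>] assms is_subringD(2)[OF sections_subring[OF ne]] by auto
  show "- s \<in> stalk T \<O> x" if "s \<in> stalk T \<O> x" for s
    using that is_subringD(5)[OF sections_subring[OF ne]] by (fastforce simp: stalk_def)
  fix s t assume "s \<in> stalk T \<O> x" "t \<in> stalk T \<O> x"
  then obtain U V where U: "openin T U" "x \<in> U" "s \<in> \<O> U" and V: "openin T V" "x \<in> V" "t \<in> \<O> V"
    by (auto simp: stalk_def)
  have UV: "openin T (U \<inter> V)" "x \<in> U \<inter> V" using U V by auto
  have "\<O> U \<subseteq> \<O> (U \<inter> V)" "\<O> V \<subseteq> \<O> (U \<inter> V)"
    by (rule subsheaf_mono[OF sheaf]; use U V UV ne in auto)+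
  then have "s \<in> \<O> (U \<inter> V)" "t \<in> \<O> (U \<inter> V)" using U V by auto
  then show "s + t \<in> stalk T \<O> x" "s * t \<in> stalk T \<O> x"
    by (auto intro!: stalkI[OF UV] is_subringD(3,4)[OF sections_subring[OF ne[OF UV]]])
qed

text \<open>The case \<open>s = 0\<close> is listed apart because \<open>inverse 0 = 0\<close> does
  lie in the stalk.\<close>

lemma max_ideal_at_iff:
  assumes "x \<in> topspace T"
  shows "s \<in> max_ideal_at T \<O> x \<longleftrightarrow> s \<in> stalk T \<O> x \<and> (s = 0 \<or> inverse s \<notin> stalk T \<O> x)"
proof -
  have "s \<in> Units (subring_of_type (stalk T \<O> x)) \<longleftrightarrow>
    s \<in> stalk T \<O> x \<and> s \<noteq> 0 \<and> inverse s \<in> stalk T \<O> x"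
    by (auto simp: Units_def inverse_unique intro!: bexI[of _ "inverse s"])
  then show ?thesis by (auto simp: max_ideal_at_def)
qed

end

section \<open>An affine open set as the spectrum of its ring of sections\<close>

locale affine_piece = int_scheme T \<O> for T :: "'a topology" and \<O> :: "'a set \<Rightarrow> 'k::field set" +
  fixes U :: "'a set"
  assumes affine: "affine_open T \<O> U"
begin

abbreviation R where "R \<equiv> \<O> U"
text \<open>The canonical map from \<open>U\<close> to \<open>Spec R\<close>; affineness makes it a
  homeomorphism, so points of \<open>U\<close> and prime ideals of \<open>R\<close> are
  interchangeable.\<close>

definition prime_at where "prime_at x = R \<inter> max_ideal_at T \<O> x"
abbreviation D where "D q \<equiv> basic_open T \<O> U q"

lemma nonempty_open: "nonempty_open T U"
  and homeo: "homeomorphic_map (subtopology T U) (zariski_topology R) prime_at"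
  and basic_sections: "\<And>f. f \<in> R \<Longrightarrow> f \<noteq> 0 \<Longrightarrow> \<O> (D f) = {g / f ^ n | g n. g \<in> R}"
  using affine by (auto simp: affine_open_def prime_at_def[abs_def])

lemma openin: "openin T U" and subset_topspace: "x \<in> U \<Longrightarrow> x \<in> topspace T"
  using nonempty_open openin_subset by (auto simp: nonempty_open_def)

lemma subring: "is_subring R" by (rule sections_subring[OF nonempty_open])

lemmas ring = is_subringD[OF subring]

lemma topspace_zariski: "topspace (zariski_topology R) = Spec R"
proof
  show "topspace (zariski_topology R) \<subseteq> Spec R"
    using openin_topspace[of "zariski_topology R"] unfolding openin_zariski_topology by blast
  have "openin (zariski_topology R) {P \<in> Spec R. \<not> R \<subseteq> P}"
    unfolding openin_zariski_topology by blast
  moreover have "\<not> R \<subseteq> P" if "P \<in> Spec R" for P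
    using that unfolding Spec_def mem_Collect_eq primeideal_subring_iff[OF subring]
      ideal_subring_iff[OF subring] by (metis subset_antisym)
  then have "{P \<in> Spec R. \<not> R \<subseteq> P} = Spec R" by blast
  ultimately show "Spec R \<subseteq> topspace (zariski_topology R)" using openin_subset by metis
qed

lemma image_prime_at: "prime_at ` U = Spec R"
  using homeomorphic_imp_surjective_map[OF homeo] subset_topspace topspace_zariski
  by (simp add: Int_absorb1 subsetI)

lemma prime_at_prime: "x \<in> U \<Longrightarrow> primeideal (prime_at x) (subring_of_type R)"
  using image_prime_at by (auto simp: Spec_def)

lemma prime_at_surj: "primeideal P (subring_of_type R) \<Longrightarrow> \<exists>x\<in>U. prime_at x = P"
  using image_prime_at unfolding Spec_def by (metis imageE mem_Collect_eq)

lemma prime_at_inj: "x \<in> U \<Longrightarrow> y \<in> U \<Longrightarrow> prime_at x = prime_at y \<Longrightarrow> x = y"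
  using homeomorphic_imp_injective_map[OF homeo] subset_topspace
  by (auto simp: inj_on_def)

lemma prime_at_ideal:
  assumes "x \<in> U"
  shows "ideal (prime_at x) (subring_of_type R)" "prime_at x \<subseteq> R" "0 \<in> prime_at x" "1 \<notin> prime_at x"
    "\<And>a b. a \<in> R \<Longrightarrow> b \<in> R \<Longrightarrow> a * b \<in> prime_at x \<longleftrightarrow> a \<in> prime_at x \<or> b \<in> prime_at x"
proof -
  have p: "ideal (prime_at x) (subring_of_type R)" "prime_at x \<noteq> R"
    "\<And>a b. a \<in> R \<Longrightarrow> b \<in> R \<Longrightarrow> a * b \<in> prime_at x \<Longrightarrow> a \<in> prime_at x \<or> b \<in> prime_at x"
    using prime_at_prime[OF assms] unfolding primeideal_subring_iff[OF subring] by auto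
  show "ideal (prime_at x) (subring_of_type R)" by fact
  note i = p(1)[unfolded ideal_subring_iff[OF subring]]
  show "prime_at x \<subseteq> R" "0 \<in> prime_at x" using i by auto
  show "1 \<notin> prime_at x"
  proof
    assume "1 \<in> prime_at x"
    then have "r * 1 \<in> prime_at x" if "r \<in> R" for r using i that by blast
    then have "R \<subseteq> prime_at x" by auto
    then show False using i p(2) by auto
  qed
  show "a * b \<in> prime_at x \<longleftrightarrow> a \<in> prime_at x \<or> b \<in> prime_at x" if "a \<in> R" "b \<in> R" for a b
    using p(3)[of a b] i that by (metis mult.commute)
qed

lemma power_prime_at: "x \<in> U \<Longrightarrow> q \<in> R \<Longrightarrow> q \<notin> prime_at x \<Longrightarrow> q ^ n \<notin> prime_at x"
  by (induction n) (use prime_at_ideal ring in auto)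

lemma mem_D: "q \<in> R \<Longrightarrow> x \<in> D q \<longleftrightarrow> x \<in> U \<and> q \<notin> prime_at x"
  by (auto simp: basic_open_def prime_at_def)

lemma D_subset: "D q \<subseteq> U"
  by (auto simp: basic_open_def)

lemma preimage_open:
  assumes "S \<subseteq> R"
  shows "openin T {x \<in> U. \<not> S \<subseteq> prime_at x}"
proof -
  have "openin (zariski_topology R) {P \<in> Spec R. \<not> S \<subseteq> P}"
    using assms unfolding openin_zariski_topology by blast
  then have "openin (subtopology T U)
      {x \<in> topspace (subtopology T U). prime_at x \<in> {P \<in> Spec R. \<not> S \<subseteq> P}}"
    using homeomorphic_imp_continuous_map[OF homeo] openin_continuous_map_preimage by blast
  moreover have "{x \<in> topspace (subtopology T U). prime_at x \<in> {P \<in> Spec R. \<not> S \<subseteq> P}} =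
      {x \<in> U. \<not> S \<subseteq> prime_at x}"
    using subset_topspace prime_at_prime by (auto simp: Spec_def)
  ultimately show ?thesis using openin openin_trans_full by metis
qed

lemma D_open: "q \<in> R \<Longrightarrow> openin T (D q)"
proof -
  assume "q \<in> R"
  then have "D q = {x \<in> U. \<not> {q} \<subseteq> prime_at x}" using mem_D by auto
  then show ?thesis using preimage_open[of "{q}"] \<open>q \<in> R\<close> by simp
qed

text \<open>Supplies the generic point of \<open>U\<close>, which lies in \<open>D q\<close> for
  every nonzero \<open>q\<close>.\<close>

lemma zero_prime: "primeideal {0} (subring_of_type R)"
  unfolding primeideal_subring_iff[OF subring] ideal_subring_iff[OF subring]
proof (intro conjI notI)
  assume "{0} = R"
  then show False using ring(2) by (metis singletonD zero_neq_one)
qed (use ring(1) in auto)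

lemma D_nonempty_open: "q \<in> R \<Longrightarrow> q \<noteq> 0 \<Longrightarrow> nonempty_open T (D q)"
  using D_open prime_at_surj[OF zero_prime] mem_D by (fastforce simp: nonempty_open_def)

text \<open>\<open>prime_at\<close> is open, so the image of \<open>V \<inter> U\<close> is given by
  a set \<open>S\<close> of nonvanishing sections, one of which does not vanish at \<open>x\<close>.
  Injectivity of \<open>prime_at\<close> carries the inclusion back to \<open>U\<close>.\<close>

lemma basis:
  assumes "openin T V" "x \<in> V" "x \<in> U"
  obtains q where "q \<in> R" "q \<notin> prime_at x" "q \<noteq> 0" "x \<in> D q" "D q \<subseteq> V"
proof -
  have "openin (subtopology T U) (V \<inter> U)"
    using assms(1) by (auto simp: openin_subtopology)
  then have "openin (zariski_topology R) (prime_at ` (V \<inter> U))"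
    using homeomorphic_imp_open_map[OF homeo] by (simp add: open_map_def)
  then obtain S where S: "S \<subseteq> R" "prime_at ` (V \<inter> U) = {P \<in> Spec R. \<not> S \<subseteq> P}"
    unfolding openin_zariski_topology by blast
  have "\<not> S \<subseteq> prime_at x" using S(2) assms by blast
  then obtain q where q: "q \<in> S" "q \<notin> prime_at x" by auto
  have qR: "q \<in> R" using q S by auto
  have "D q \<subseteq> V"
  proof
    fix y assume y: "y \<in> D q"
    then have "y \<in> U" "q \<notin> prime_at y" using mem_D[OF qR] by auto
    then have "prime_at y \<in> prime_at ` (V \<inter> U)"
      using q S prime_at_prime by (auto simp: Spec_def)
    then show "y \<in> V" using prime_at_inj \<open>y \<in> U\<close> by blast
  qed
  moreover have "q \<noteq> 0" using q prime_at_ideal(3)[OF assms(3)] by auto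
  ultimately show thesis using that[OF qR] q mem_D[OF qR] assms by auto
qed

section \<open>Germs over an affine open set as fractions\<close>

lemma stalk_basic:
  assumes F: "subsheaf_of_constant T F" and x: "x \<in> U" and s: "s \<in> stalk T F x"
  obtains q where "q \<in> R" "q \<notin> prime_at x" "q \<noteq> 0" "x \<in> D q" "s \<in> F (D q)"
proof -
  obtain V where V: "openin T V" "x \<in> V" "s \<in> F V" using s by (auto simp: stalk_def)
  obtain q where q: "q \<in> R" "q \<notin> prime_at x" "q \<noteq> 0" "x \<in> D q" "D q \<subseteq> V"
    by (rule basis[OF V(1,2) x])
  have "F V \<subseteq> F (D q)"
    using V q D_nonempty_open by (intro subsheaf_mono[OF F]) (auto simp: nonempty_open_def)
  then show thesis using that q V by blast
qed

text \<open>The scalar multiplication stays a parameter so that the lemma covers both the ideals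
  \<open>\<aa> m\<close> and the sheaves of Cartier maps \<open>\<D> e\<close>.\<close>

lemma stalk_quasi_coherent:
  assumes "subsheaf_of_constant T F" "quasi_coherent T \<O> scl F" "x \<in> U" "s \<in> stalk T F x"
  obtains q n r where "q \<in> R" "q \<notin> prime_at x" "q \<noteq> 0" "r \<in> F U" "s = scl (inverse (q ^ n)) r"
proof -
  obtain q where q: "q \<in> R" "q \<notin> prime_at x" "q \<noteq> 0" "x \<in> D q" "s \<in> F (D q)"
    by (rule stalk_basic[OF assms(1,3,4)])
  have "F (D q) = {scl (inverse (q ^ n)) r | r n. r \<in> F U}"
    using assms(2) affine q(1,3) by (simp add: quasi_coherent_def)
  then obtain r n where "r \<in> F U" "s = scl (inverse (q ^ n)) r" using q(5) by auto
  then show thesis by (intro that[OF q(1-3)])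
qed

lemma stalk_fraction:
  assumes "x \<in> U" "s \<in> stalk T \<O> x"
  obtains q g where "q \<in> R" "q \<notin> prime_at x" "q \<noteq> 0" "g \<in> R" "s = g / q"
proof -
  obtain q where q: "q \<in> R" "q \<notin> prime_at x" "q \<noteq> 0" "x \<in> D q" "s \<in> \<O> (D q)"
    by (rule stalk_basic[OF sheaf assms])
  then obtain g n where "s = g / q ^ n" "g \<in> R" using basic_sections[of q] by auto
  moreover have "q ^ n \<in> R" "q ^ n \<notin> prime_at x" "q ^ n \<noteq> 0"
    using q(1-3) ring(6) power_prime_at[OF assms(1)] by auto
  ultimately show thesis using that[of "q ^ n" g] by blast
qed

lemma sections_subset_stalk: "x \<in> U \<Longrightarrow> F U \<subseteq> stalk T F x"
  using openin by (auto simp: stalk_def)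

text \<open>Every element of the function field is a section over some nonempty open set. By
  irreducibility that set meets \<open>U\<close>, where the element is a germ and hence a
  fraction.\<close>

lemma fraction_field: "\<exists>g\<in>R. \<exists>h\<in>R. h \<noteq> 0 \<and> z = g / h"
proof -
  obtain V where V: "nonempty_open T V" "z \<in> \<O> V"
    using integral UNIV_I[of z] unfolding integral_scheme_def by blast
  then obtain x where x: "x \<in> U \<inter> V" "openin T V"
    using nonempty_open_Int[OF irreducible nonempty_open V(1)] by (auto simp: nonempty_open_def)
  then have "z \<in> stalk T \<O> x" using V(2) by (intro stalkI[of T V]) auto
  moreover have "x \<in> U" using x by simp
  ultimately obtain q g where "q \<in> R" "q \<notin> prime_at x" "q \<noteq> 0" "g \<in> R" "z = g / q"
    by (elim stalk_fraction[rotated])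
  then show ?thesis by blast
qed

section \<open>Centers of valuations\<close>

lemma centered_atD:
  assumes "x \<in> U" "centered_at T \<O> v x"
  shows "\<And>r. r \<in> R \<Longrightarrow> v r \<ge> 0" "prime_at x = R \<inter> {r. v r > 0}"
proof -
  have s: "R \<subseteq> stalk T \<O> x" using sections_subset_stalk[OF assms(1)] .
  show "v r \<ge> 0" if "r \<in> R" for r using assms(2) s that by (auto simp: centered_at_def)
  show "prime_at x = R \<inter> {r. v r > 0}" using assms(2) s by (auto simp: centered_at_def prime_at_def)
qed

text \<open>Reduces a condition on the stalk to one on \<open>R\<close>: a germ is
  \<open>g / q\<close> with \<open>q\<close> outside \<open>prime_at x\<close>, so
  \<open>v q = 0\<close> and the germ has the same value as \<open>g\<close>.\<close>

lemma centered_atI: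
  assumes v: "is_valuation v" and x: "x \<in> U" and pos: "\<And>r. r \<in> R \<Longrightarrow> v r \<ge> 0"
    and P: "prime_at x = R \<inter> {r. v r > 0}"
  shows "centered_at T \<O> v x"
proof -
  have xT: "x \<in> topspace T" by (rule subset_topspace[OF x])
  have q0: "v q = 0" if "q \<in> R" "q \<notin> prime_at x" for q using that P pos[of q] by (auto simp: less_le)
  have ge: "v s \<ge> 0" if s: "s \<in> stalk T \<O> x" for s
  proof -
    obtain q g where "q \<in> R" "q \<notin> prime_at x" "q \<noteq> 0" "g \<in> R" "s = g / q"
      by (rule stalk_fraction[OF x s])
    then show ?thesis using valuation_divide[OF v, of q g] q0[of q] pos[of g] by simp
  qed
  have "s \<in> max_ideal_at T \<O> x \<longleftrightarrow> v s > 0" if s: "s \<in> stalk T \<O> x" for s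
  proof (cases "s = 0")
    case True
    then show ?thesis using s is_valuationD(1)[OF v] by (simp add: max_ideal_at_iff[OF xT])
  next
    case False
    obtain q g where q: "q \<in> R" "q \<notin> prime_at x" "q \<noteq> 0" "g \<in> R" "s = g / q"
      by (rule stalk_fraction[OF x s])
    have vs: "v s = v g" using q q0[of q] valuation_divide[OF v, of q g] by simp
    have g0: "g \<noteq> 0" using False q by auto
    show ?thesis
    proof (cases "v s = 0")
      case True
      then have "g \<notin> prime_at x" using P vs by auto
      then have "inverse g \<in> stalk T \<O> x"
        using q(4) g0 max_ideal_at_iff[OF xT, of g] sections_subset_stalk[OF x, of \<O>]
        by (auto simp: prime_at_def)
      then have "q * inverse g \<in> stalk T \<O> x"
        using is_subringD(4)[OF stalk_subring[OF xT]] sections_subset_stalk[OF x, of \<O>] q by blast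
      then have "inverse s \<in> stalk T \<O> x"
        unfolding q(5) by (simp add: divide_inverse mult.commute)
      then show ?thesis using True False max_ideal_at_iff[OF xT] by simp
    next
      case False
      then have "v s > 0" using ge[OF s] by simp
      moreover have "inverse s \<notin> stalk T \<O> x"
      proof
        assume "inverse s \<in> stalk T \<O> x"
        from ge[OF this] have "v s \<le> 0"
          using valuation_inverse[OF v \<open>s \<noteq> 0\<close>] by (cases "v s") auto
        then show False using \<open>v s > 0\<close> by simp
      qed
      ultimately show ?thesis using max_ideal_at_iff[OF xT] s by simp
    qed
  qed
  then show ?thesis using ge xT by (auto simp: centered_at_def max_ideal_at_def)
qed

end

text \<open>The uniqueness half of the valuative criterion. By separatedness the sections over
  \<open>U \<inter> W\<close> are generated by those over \<open>U\<close> and over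
  \<open>W\<close>, and \<open>v\<close> is nonnegative on both, hence on all of them.\<close>

lemma (in int_scheme) center_unique:
  fixes v :: "'k \<Rightarrow> ereal"
  assumes sep: "separated_scheme T \<O>" and v: "is_valuation v"
    and x: "centered_at T \<O> v x" and y: "centered_at T \<O> v y"
  shows "x = y"
proof -
  obtain U where U: "affine_open T \<O> U" "x \<in> U"
    using x integral by (auto simp: centered_at_def integral_scheme_def)
  obtain W where W: "affine_open T \<O> W" "y \<in> W"
    using y integral by (auto simp: centered_at_def integral_scheme_def)
  interpret U: affine_piece T \<O> U by unfold_locales (rule U)
  interpret W: affine_piece T \<O> W by unfold_locales (rule W)
  have UW: "affine_open T \<O> (U \<inter> W)" "\<O> (U \<inter> W) = generate_ring ring_of_type_algebra (\<O> U \<union> \<O> W)"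
    using sep U W by (auto simp: separated_scheme_def)
  interpret I: affine_piece T \<O> "U \<inter> W" by unfold_locales (rule UW)
  note pos = U.centered_atD[OF U(2) x] W.centered_atD[OF W(2) y]
  interpret K: cring "ring_of_type_algebra :: 'k ring" by blast
  have [simp]: "a_inv ring_of_type_algebra x = - x" for x :: 'k
    by (rule K.minus_equality) (auto simp: ring_of_type_algebra_def)
  have vneg: "v (- a) = v a" for a
  proof -
    have "v (-1) + v (-1) = 0" using is_valuationD(3)[OF v, of "-1" "-1"] valuation_one[OF v] by simp
    then have "v (-1) = 0" by (cases "v (-1)") auto
    then show ?thesis using is_valuationD(3)[OF v, of "-1" a] by simp
  qed
  have ge: "v r \<ge> 0" if "r \<in> generate_ring ring_of_type_algebra (\<O> U \<union> \<O> W)" for r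
    using that
  proof induction
    case one
    then show ?case using valuation_one[OF v] by (simp add: ring_of_type_algebra_def)
  next
    case (incl h)
    then show ?case using pos by auto
  next
    case (a_inv h)
    then show ?case using pos vneg by auto
  next
    case (eng_add a b)
    then show ?case using is_valuationD(4)[OF v, of a b] by (auto simp: ring_of_type_algebra_def min_def split: if_splits)
  next
    case (eng_mult a b)
    then show ?case using is_valuationD(3)[OF v, of a b] by (auto simp: ring_of_type_algebra_def)
  qed
  \<comment> \<open>So \<open>v\<close> has a center in \<open>U \<inter> W\<close>, and this point must be both \<open>x\<close> and \<open>y\<close>.\<close>
  let ?P = "\<O> (U \<inter> W) \<inter> {r. v r > 0}"
  have "primeideal ?P (subring_of_type (\<O> (U \<inter> W)))"
    unfolding primeideal_subring_iff[OF I.subring] ideal_subring_iff[OF I.subring]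
  proof (intro conjI ballI impI)
    show "?P \<noteq> \<O> (U \<inter> W)" using I.ring(2) valuation_one[OF v] by force
    show "a + b \<in> ?P" if "a \<in> ?P" "b \<in> ?P" for a b
      using that is_valuationD(4)[OF v, of a b] I.ring by (auto simp: min_def split: if_splits)
    show "r * a \<in> ?P" if "a \<in> ?P" "r \<in> \<O> (U \<inter> W)" for a r
      using that is_valuationD(3)[OF v, of r a] I.ring(4) ge[of r] UW(2) by (simp add: add_nonneg_pos)
    show "a \<in> ?P \<or> b \<in> ?P" if "a * b \<in> ?P" "a \<in> \<O> (U \<inter> W)" "b \<in> \<O> (U \<inter> W)" for a b
      using that is_valuationD(3)[OF v, of a b] ge[of a] ge[of b] UW(2) by (auto simp: less_le)
  qed (use I.ring is_valuationD(1)[OF v] in auto)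
  then obtain z where z: "z \<in> U \<inter> W" "I.prime_at z = ?P" using I.prime_at_surj by blast
  have "\<O> U \<subseteq> \<O> (U \<inter> W)" "\<O> W \<subseteq> \<O> (U \<inter> W)"
    using subsheaf_mono[OF sheaf] U.nonempty_open W.nonempty_open I.nonempty_open by auto
  then have "U.prime_at z = \<O> U \<inter> {r. v r > 0}" "W.prime_at z = \<O> W \<inter> {r. v r > 0}"
    using z(2) by (auto simp: I.prime_at_def U.prime_at_def W.prime_at_def)
  then show ?thesis
    using U.prime_at_inj[of x z] W.prime_at_inj[of y z] pos U W z by auto
qed

lemma (in int_scheme) center_of_eq:
  assumes "separated_scheme T \<O>" "is_valuation v" "centered_at T \<O> v x"
  shows "center_of T \<O> v = x"
  unfolding center_of_def using assms center_unique by (intro the_equality) auto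

section \<open>Affine open sets of a noetherian scheme\<close>

text \<open>Every monomial in the expansion of the power is divisible by \<open>q ^ m\<close> or
  \<open>r ^ n\<close>. In place of the binomial theorem, the induction peels off one factor
  \<open>q + r\<close> and moves its summands onto \<open>y\<close>.\<close>

lemma ideal_power_sum:
  assumes R: "is_subring R" and K: "ideal K (subring_of_type R)" and q: "q \<in> R" "r \<in> R"
    and "q ^ m * y \<in> K" "r ^ n * y \<in> K"
  shows "(q + r) ^ (m + n) * y \<in> K"
  using assms(5,6)
proof (induction "m + n" arbitrary: m n y)
  case 0
  then show ?case by simp
next
  case (Suc k)
  note K' = K[unfolded ideal_subring_iff[OF R]]
  have "(q + r) ^ (m + n) \<in> R" using is_subringD(3,6)[OF R] q by blast
  \<comment> \<open>Settles \<open>m = 0\<close> and \<open>n = 0\<close>, where one of the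
    hypotheses already says that \<open>y\<close> lies in \<open>K\<close>.\<close>
  then have y: "y \<in> K \<Longrightarrow> ?case" using K' by blast
  show ?case
  proof (cases "m = 0 \<or> n = 0")
    case True
    then show ?thesis using Suc.prems y by auto
  next
    case False
    then obtain m' n' where mn: "m = Suc m'" "n = Suc n'" by (meson not0_implies_Suc)
    have 1: "q ^ m' * (q * y) \<in> K" using Suc.prems(1) mn by (simp add: ac_simps)
    have "q * (r ^ n * y) \<in> K" using K' Suc.prems(2) q by blast
    then have 2: "r ^ n * (q * y) \<in> K" by (simp add: ac_simps)
    have 3: "r ^ n' * (r * y) \<in> K" using Suc.prems(2) mn by (simp add: ac_simps)
    have "r * (q ^ m * y) \<in> K" using K' Suc.prems(1) q by blast
    then have 4: "q ^ m * (r * y) \<in> K" by (simp add: ac_simps)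
    have "(q + r) ^ (m' + n) * (q * y) \<in> K" by (rule Suc.hyps(1)) (use Suc.hyps(2) mn 1 2 in auto)
    moreover have "(q + r) ^ (m + n') * (r * y) \<in> K"
      by (rule Suc.hyps(1)) (use Suc.hyps(2) mn 3 4 in auto)
    ultimately have "(q + r) ^ (m' + n) * (q * y) + (q + r) ^ (m + n') * (r * y) \<in> K" using K' by blast
    moreover have "(q + r) ^ (m + n) * y = (q + r) ^ (m' + n) * (q * y) + (q + r) ^ (m + n') * (r * y)"
      by (simp add: mn algebra_simps)
    ultimately show ?thesis by simp
  qed
qed

context affine_piece
begin

lemma inverse_mem_stalk:
  assumes "x \<in> U" "q \<in> R" "q \<notin> prime_at x"
  shows "inverse q \<in> stalk T \<O> x"
  using assms sections_subset_stalk[OF assms(1), of \<O>] max_ideal_at_iff[OF subset_topspace[OF assms(1)]]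
  by (auto simp: prime_at_def)

text \<open>Nested basic open sets around \<open>x\<close>, \<open>W.D g\<close> inside
  \<open>D f\<close> inside \<open>W\<close>, make powers of \<open>f\<close> carry
  \<open>\<O> W\<close> into \<open>R\<close> and powers of \<open>g\<close> carry \<open>R\<close>
  into \<open>\<O> W\<close>. The element \<open>h\<close> brings \<open>g\<close> itself into
  \<open>R\<close>, so powers of \<open>f * h\<close> serve as a common denominator.\<close>

lemma common_basic_open:
  assumes W: "affine_piece T \<O> W" and x: "x \<in> U" "x \<in> W"
  obtains f h g n where "f \<in> R" "f \<noteq> 0" "h \<in> R" "f * h \<notin> prime_at x" "g \<in> \<O> W" "h = f ^ n * g"
    "\<forall>w\<in>\<O> W. \<exists>k. f ^ k * w \<in> R" "\<forall>r\<in>R. \<exists>k. g ^ k * r \<in> \<O> W"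
proof -
  interpret W: affine_piece T \<O> W by fact
  obtain f where f: "f \<in> R" "f \<notin> prime_at x" "f \<noteq> 0" "x \<in> D f" "D f \<subseteq> W"
    by (rule basis[OF W.openin x(2,1)])
  obtain g where g: "g \<in> \<O> W" "g \<notin> W.prime_at x" "g \<noteq> 0" "x \<in> W.D g" "W.D g \<subseteq> D f"
    by (rule W.basis[OF D_open[OF f(1)] f(4) x(2)])
  have sub1: "\<O> W \<subseteq> \<O> (D f)"
    by (rule subsheaf_mono[OF sheaf W.nonempty_open D_nonempty_open[OF f(1,3)] f(5)])
  have sub2: "R \<subseteq> \<O> (W.D g)"
    using g(5) D_subset by (intro subsheaf_mono[OF sheaf nonempty_open W.D_nonempty_open[OF g(1,3)]]) blast
  have loc1: "\<exists>k. f ^ k * w \<in> R" if "w \<in> \<O> W" for w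
  proof -
    have "w \<in> {a / f ^ n | a n. a \<in> R}" using that sub1 basic_sections[OF f(1,3)] by blast
    then obtain a n where "w = a / f ^ n" "a \<in> R" by auto
    then have "f ^ n * w \<in> R" using f(3) by simp
    then show ?thesis by blast
  qed
  have loc2: "\<exists>k. g ^ k * r \<in> \<O> W" if "r \<in> R" for r
  proof -
    have "r \<in> {a / g ^ n | a n. a \<in> \<O> W}" using that sub2 W.basic_sections[OF g(1,3)] by blast
    then obtain a n where "r = a / g ^ n" "a \<in> \<O> W" by auto
    then have "g ^ n * r \<in> \<O> W" using g(3) by simp
    then show ?thesis by blast
  qed
  obtain n where n: "f ^ n * g \<in> R" using loc1[OF g(1)] by blast
  define h where "h = f ^ n * g"
  \<comment> \<open>\<open>g\<close> is a section over \<open>W\<close> and need not lie in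
    \<open>R\<close>, so primality of \<open>prime_at x\<close> does not apply to the product.
    Instead \<open>h\<close> is shown to be a unit of the stalk.\<close>
  have "h \<notin> prime_at x"
  proof
    assume "h \<in> prime_at x"
    have xT: "x \<in> topspace T" using subset_topspace x(1) by simp
    have "inverse g \<in> stalk T \<O> x" using W.inverse_mem_stalk[OF x(2) g(1,2)] .
    moreover have "f ^ n \<notin> prime_at x" "f ^ n \<in> R" using power_prime_at[OF x(1) f(1,2)] ring(6)[OF f(1)] by auto
    then have "inverse (f ^ n) \<in> stalk T \<O> x" using inverse_mem_stalk[OF x(1)] by blast
    ultimately have "inverse (f ^ n) * inverse g \<in> stalk T \<O> x"
      using is_subringD(4)[OF stalk_subring[OF xT]] by blast
    then have "inverse h \<in> stalk T \<O> x" by (simp add: h_def)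
    moreover have "h \<noteq> 0" using f g by (simp add: h_def)
    ultimately show False
      using \<open>h \<in> prime_at x\<close> max_ideal_at_iff[OF xT] by (auto simp: prime_at_def)
  qed
  then have "f * h \<notin> prime_at x" using prime_at_ideal(5)[OF x(1) f(1), of h] f n h_def by auto
  then show thesis by (intro that[OF f(1,3) _ _ g(1) h_def]) (use n h_def loc1 loc2 in auto)
qed

text \<open>Expresses without localizing that \<open>I\<close> is generated by finitely many of its
  elements once \<open>q\<close> is inverted.\<close>

definition locally_generated where
  "locally_generated I q \<longleftrightarrow> (\<exists>S. finite S \<and> S \<subseteq> I \<and>
     (\<forall>y\<in>I. \<exists>N. q ^ N * y \<in> genideal (subring_of_type R) S))"

lemma ideal_facts:
  assumes "ideal K (subring_of_type R)"
  shows "K \<subseteq> R" "0 \<in> K" "\<And>a b. a \<in> K \<Longrightarrow> b \<in> K \<Longrightarrow> a + b \<in> K" "\<And>r a. r \<in> R \<Longrightarrow> a \<in> K \<Longrightarrow> r * a \<in> K"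
  using assms unfolding ideal_subring_iff[OF subring] by auto

lemma genideal_facts:
  assumes "S \<subseteq> R"
  shows "ideal (genideal (subring_of_type R) S) (subring_of_type R)"
    "S \<subseteq> genideal (subring_of_type R) S"
    "\<And>K. ideal K (subring_of_type R) \<Longrightarrow> S \<subseteq> K \<Longrightarrow> genideal (subring_of_type R) S \<subseteq> K"
proof -
  interpret cring "subring_of_type R" by (rule cring_subring_of_type[OF subring])
  show "ideal (genideal (subring_of_type R) S) (subring_of_type R)"
    "S \<subseteq> genideal (subring_of_type R) S"
    "\<And>K. ideal K (subring_of_type R) \<Longrightarrow> S \<subseteq> K \<Longrightarrow> genideal (subring_of_type R) S \<subseteq> K"
    using genideal_ideal[of S] genideal_self[of S] genideal_minimal[of _ S] assms by auto
qed

text \<open>The noetherian hypothesis concerns the members of one affine cover. The ideal is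
  therefore moved to a member \<open>W\<close> containing \<open>x\<close>, where the elements that
  some power of \<open>?q\<close> brings into \<open>I\<close> form a finitely generated ideal, and
  its generators are scaled back into \<open>I\<close>.\<close>

lemma locally_generated_at:
  assumes noeth: "noetherian_scheme T \<O>" and x: "x \<in> U" and I: "ideal I (subring_of_type R)"
  shows "\<exists>q\<in>R. q \<notin> prime_at x \<and> locally_generated I q"
proof -
  obtain W where W: "affine_open T \<O> W" "noetherian_ring (subring_of_type (\<O> W))" "x \<in> W"
    using noeth subset_topspace[OF x] unfolding noetherian_scheme_def by blast
  interpret W: affine_piece T \<O> W by unfold_locales (rule W(1))
  interpret N: noetherian_ring "subring_of_type (\<O> W)" by (rule W(2))
  obtain f h g n where f: "f \<in> R" "f \<noteq> 0" and h: "h \<in> R" "f * h \<notin> prime_at x"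
    and g: "g \<in> \<O> W" "h = f ^ n * g"
    and loc1: "\<forall>w\<in>\<O> W. \<exists>k. f ^ k * w \<in> R" and loc2: "\<forall>r\<in>R. \<exists>k. g ^ k * r \<in> \<O> W"
    by (rule common_basic_open[OF W.affine_piece_axioms x W(3)])
  let ?q = "f * h"
  have q: "?q \<in> R" using f h ring by blast
  \<comment> \<open>Stated for general \<open>K\<close> because it serves for \<open>I\<close> and
    then for the ideal generated by \<open>S\<close>.\<close>
  have J_ideal: "ideal {w \<in> \<O> W. \<exists>N. ?q ^ N * w \<in> K} (subring_of_type (\<O> W))"
    if K: "ideal K (subring_of_type R)" for K
    unfolding ideal_subring_iff[OF W.subring]
  proof (intro conjI ballI)
    show "0 \<in> {w \<in> \<O> W. \<exists>N. ?q ^ N * w \<in> K}" using ideal_facts[OF K] W.ring by simp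
  next
    fix a b assume "a \<in> {w \<in> \<O> W. \<exists>N. ?q ^ N * w \<in> K}" "b \<in> {w \<in> \<O> W. \<exists>N. ?q ^ N * w \<in> K}"
    then obtain M N where a: "a \<in> \<O> W" "?q ^ M * a \<in> K" and b: "b \<in> \<O> W" "?q ^ N * b \<in> K" by blast
    have "?q ^ N * (?q ^ M * a) + ?q ^ M * (?q ^ N * b) \<in> K"
      by (intro ideal_facts(3,4)[OF K] ring(6)[OF q] a b)
    moreover have "?q ^ N * (?q ^ M * a) + ?q ^ M * (?q ^ N * b) = ?q ^ (M + N) * (a + b)"
      by (simp add: power_add algebra_simps)
    ultimately have "?q ^ (M + N) * (a + b) \<in> K" by simp
    then show "a + b \<in> {w \<in> \<O> W. \<exists>N. ?q ^ N * w \<in> K}" using W.ring(3) a b by blast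
  next
    fix a w assume "a \<in> {w \<in> \<O> W. \<exists>N. ?q ^ N * w \<in> K}" and w: "w \<in> \<O> W"
    then obtain N where a: "a \<in> \<O> W" "?q ^ N * a \<in> K" by blast
    obtain k where k: "f ^ k * w \<in> R" using loc1 w by blast
    \<comment> \<open>\<open>w\<close> need not lie in \<open>R\<close>: \<open>f ^ k\<close> brings
      it there, and \<open>h ^ k\<close> completes \<open>f ^ k\<close> to a power of
      \<open>?q\<close>.\<close>
    have "h ^ k * ((f ^ k * w) * (?q ^ N * a)) \<in> K"
      by (intro ideal_facts(4)[OF K] ring(6) h k a)
    then have "?q ^ (N + k) * (w * a) \<in> K" by (simp add: power_add power_mult_distrib mult_ac)
    then show "w * a \<in> {w \<in> \<O> W. \<exists>N. ?q ^ N * w \<in> K}" using W.ring(4) a w by blast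
  qed auto
  let ?J = "{w \<in> \<O> W. \<exists>N. ?q ^ N * w \<in> I}"
  obtain A where A: "A \<subseteq> \<O> W" "finite A" "?J = genideal (subring_of_type (\<O> W)) A"
    using N.finetely_gen[OF J_ideal[OF I]] by auto
  have "\<exists>N. ?q ^ N * a \<in> I" if "a \<in> A" for a using A(3) W.genideal_facts(2)[OF A(1)] that by blast
  then obtain N where N: "\<And>a. a \<in> A \<Longrightarrow> ?q ^ N a * a \<in> I" by metis
  define S where "S = (\<lambda>a. ?q ^ N a * a) ` A"
  have S: "finite S" "S \<subseteq> I" "S \<subseteq> R" using A N ideal_facts(1)[OF I] by (auto simp: S_def)
  note G = genideal_facts(1,2)[OF S(3)]
  have "A \<subseteq> {w \<in> \<O> W. \<exists>N. ?q ^ N * w \<in> genideal (subring_of_type R) S}"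
    using A(1) G(2) by (auto simp: S_def)
  then have sub: "?J \<subseteq> {w \<in> \<O> W. \<exists>N. ?q ^ N * w \<in> genideal (subring_of_type R) S}"
    unfolding A(3) by (intro W.genideal_facts(3)[OF A(1)] J_ideal[OF G(1)])
  have "\<exists>N. ?q ^ N * y \<in> genideal (subring_of_type R) S" if y: "y \<in> I" for y
  proof -
    obtain k where k: "g ^ k * y \<in> \<O> W" using loc2 y ideal_facts(1)[OF I] by blast
    have hk: "h ^ k = f ^ (n * k) * g ^ k" by (simp add: g(2) power_mult_distrib power_mult)
    \<comment> \<open>Since \<open>h ^ k = f ^ (n * k) * g ^ k\<close>, this multiplier turns
      \<open>y\<close> into \<open>?q ^ (n * k) * (g ^ k * y)\<close>. The factor
      \<open>f ^ (n * k) * f ^ k\<close> below undoes the passage, as it turns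
      \<open>g ^ k * y\<close> into \<open>?q ^ k * y\<close>.\<close>
    have "h ^ (n * k) * h ^ k \<in> R" using ring(4,6) h by blast
    from ideal_facts(4)[OF I this y] have "(h ^ (n * k) * h ^ k) * y \<in> I" .
    then have "?q ^ (n * k) * (g ^ k * y) \<in> I"
      by (simp add: power_mult_distrib hk mult_ac)
    then have "g ^ k * y \<in> ?J" using k by blast
    then obtain M where M: "?q ^ M * (g ^ k * y) \<in> genideal (subring_of_type R) S" using sub by blast
    have "f ^ (n * k) * f ^ k \<in> R" using ring(4,6) f by blast
    from ideal_facts(4)[OF G(1) this M] have "?q ^ (M + k) * y \<in> genideal (subring_of_type R) S"
      by (simp add: power_add power_mult_distrib hk mult_ac)
    then show ?thesis by blast
  qed
  then show ?thesis using q h S by (auto simp: locally_generated_def)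
qed

text \<open>For \<open>q = 1\<close>, \<open>locally_generated\<close> is finite generation. Since
  the admissible \<open>q\<close> form an ideal, existence of such a \<open>q\<close> at each point
  suffices, and no finite subcover has to be extracted.\<close>

lemma ideal_finitely_generated:
  assumes noeth: "noetherian_scheme T \<O>" and I: "ideal I (subring_of_type R)"
  shows "\<exists>S. finite S \<and> S \<subseteq> I \<and> I = genideal (subring_of_type R) S"
proof -
  let ?G = "\<lambda>S. genideal (subring_of_type R) S"
  \<comment> \<open>\<open>Q\<close> is an ideal contained in no prime ideal.\<close>
  define Q where "Q = {q \<in> R. locally_generated I q}"
  have SR: "S \<subseteq> I \<Longrightarrow> S \<subseteq> R" for S using ideal_facts(1)[OF I] by blast
  have "ideal Q (subring_of_type R)"
    unfolding ideal_subring_iff[OF subring]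
  proof (intro conjI ballI)
    \<comment> \<open>The exponent must be positive, because \<open>0 ^ 0 = 1\<close>.\<close>
    have "0 ^ 1 * y \<in> ?G {}" for y using ideal_facts(2)[OF genideal_facts(1)[of "{}"]] by simp
    then have "locally_generated I 0"
      unfolding locally_generated_def by (intro exI[of _ "{}"]) blast
    then show "0 \<in> Q" using ring by (auto simp: Q_def)
  next
    fix a b assume "a \<in> Q" "b \<in> Q"
    then have ab: "a \<in> R" "locally_generated I a" "b \<in> R" "locally_generated I b"
      by (auto simp: Q_def)
    from ab(2) obtain A where a: "finite A" "A \<subseteq> I" "\<And>y. y \<in> I \<Longrightarrow> \<exists>N. a ^ N * y \<in> ?G A"
      unfolding locally_generated_def by blast
    from ab(4) obtain B where b: "finite B" "B \<subseteq> I" "\<And>y. y \<in> I \<Longrightarrow> \<exists>N. b ^ N * y \<in> ?G B"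
      unfolding locally_generated_def by blast
    have AB: "A \<union> B \<subseteq> R" using SR a b by blast
    note G = genideal_facts[OF AB]
    have "?G A \<subseteq> ?G (A \<union> B)" "?G B \<subseteq> ?G (A \<union> B)"
      by (intro genideal_facts(3)[OF _ G(1)]; use AB G(2) in blast)+
    then have "\<exists>N. (a + b) ^ N * y \<in> ?G (A \<union> B)" if "y \<in> I" for y
      using a(3)[OF that] b(3)[OF that] ideal_power_sum[OF subring G(1) ab(1,3)] by blast
    then have "locally_generated I (a + b)"
      unfolding locally_generated_def using a b by (intro exI[of _ "A \<union> B"]) blast
    then show "a + b \<in> Q" using ab ring by (auto simp: Q_def)
  next
    fix a r assume "a \<in> Q" and r: "r \<in> R"
    then have "a \<in> R" "locally_generated I a" by (auto simp: Q_def)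
    then obtain A where a: "a \<in> R" "finite A" "A \<subseteq> I" "\<And>y. y \<in> I \<Longrightarrow> \<exists>N. a ^ N * y \<in> ?G A"
      unfolding locally_generated_def by blast
    have "\<exists>N. (r * a) ^ N * y \<in> ?G A" if y: "y \<in> I" for y
    proof -
      obtain N where "a ^ N * y \<in> ?G A" using a(4)[OF y] by blast
      then have "r ^ N * (a ^ N * y) \<in> ?G A"
        by (rule ideal_facts(4)[OF genideal_facts(1)[OF SR[OF a(3)]] ring(6)[OF r]])
      then have "(r * a) ^ N * y \<in> ?G A" by (simp add: power_mult_distrib mult.assoc)
      then show ?thesis by blast
    qed
    then have "locally_generated I (r * a)" unfolding locally_generated_def using a by blast
    then show "r * a \<in> Q" using a r ring by (auto simp: Q_def)
  qed (auto simp: Q_def)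
  moreover have "\<not> Q \<subseteq> P" if P: "primeideal P (subring_of_type R)" for P
    using prime_at_surj[OF P] locally_generated_at[OF noeth _ I] by (auto simp: Q_def)
  ultimately have "1 \<in> Q" using primeideal_existence[OF subring] by blast
  then obtain S where S: "finite S" "S \<subseteq> I" "\<And>y. y \<in> I \<Longrightarrow> y \<in> ?G S"
    unfolding Q_def locally_generated_def by auto
  moreover have "?G S \<subseteq> I" using genideal_facts(3)[OF SR[OF S(2)] I] S(2) by blast
  ultimately show ?thesis by blast
qed

end

section \<open>Cartier maps over an affine open set\<close>

lemma p_inv_linearD:
  assumes "p_inv_linear p e \<psi>"
  shows "\<And>f g. \<psi> (f + g) = \<psi> f + \<psi> g" "\<And>f g. \<psi> (f ^ (p ^ e) * g) = f * \<psi> g" "\<psi> 0 = 0"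
proof -
  show "\<And>f g. \<psi> (f + g) = \<psi> f + \<psi> g" and lin: "\<And>f g. \<psi> (f ^ (p ^ e) * g) = f * \<psi> g"
    using assms by (auto simp: p_inv_linear_def)
  show "\<psi> 0 = 0" using lin[of 0 0] by simp
qed

lemma p_inv_linear_twisted_sum:
  assumes "\<And>i. i < n \<Longrightarrow> p_inv_linear p e (\<phi> i)"
  shows "p_inv_linear p e (\<lambda>g. \<Sum>i<n. \<phi> i (a i * g))"
proof -
  have "\<phi> i (a i * (f + g)) = \<phi> i (a i * f) + \<phi> i (a i * g)" if "i < n" for i f g
    using p_inv_linearD(1)[OF assms[OF that]] by (simp add: distrib_left)
  moreover have "\<phi> i (a i * (f ^ (p ^ e) * g)) = f * \<phi> i (a i * g)" if "i < n" for i f g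
    using p_inv_linearD(2)[OF assms[OF that], of f "a i * g"] by (simp add: mult.left_commute)
  ultimately show ?thesis
    by (simp add: p_inv_linear_def sum.distrib sum_distrib_left)
qed

text \<open>
  Iterating \<open>s \<cdot> \<psi>\<close> instead of \<open>\<psi>\<close> only introduces powers of \<open>s\<close>.  The free exponent \<open>i\<close> lets the
  induction arrange that the power of \<open>s\<close> to be moved through \<open>\<psi>\<close> is a \<open>p ^ e\<close>-th power.
\<close>
lemma iterate_scaled_map:
  assumes lin: "p_inv_linear p e \<psi>" and p: "1 \<le> p"
  shows "\<exists>M j. \<forall>i h. ((\<lambda>g. s * \<psi> g) ^^ n) (s ^ (j + p ^ (e * n) * i) * h) = s ^ (M + i) * (\<psi> ^^ n) h"
proof (induction n)
  case 0
  show ?case by (intro exI[of _ 0]) simp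
next
  case (Suc n)
  then obtain M j where IH: "\<And>i h. ((\<lambda>g. s * \<psi> g) ^^ n) (s ^ (j + p ^ (e * n) * i) * h) =
    s ^ (M + i) * (\<psi> ^^ n) h" by blast
  have "((\<lambda>g. s * \<psi> g) ^^ Suc n) (s ^ (j + p ^ (e * n) * (M * (p ^ e - 1)) + p ^ (e * Suc n) * i) * h) =
    s ^ (M + 1 + i) * (\<psi> ^^ Suc n) h" for i h
  proof -
    let ?i = "M * (p ^ e - 1) + p ^ e * i"
    have "p ^ e \<noteq> 0" using p by simp
    then obtain P where "p ^ e = Suc P" using not0_implies_Suc by blast
    then have pe: "M + ?i = (M + i) * p ^ e" by (simp add: algebra_simps)
    have "j + p ^ (e * n) * (M * (p ^ e - 1)) + p ^ (e * Suc n) * i = j + p ^ (e * n) * ?i"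
      by (simp add: algebra_simps power_add)
    then have "((\<lambda>g. s * \<psi> g) ^^ Suc n) (s ^ (j + p ^ (e * n) * (M * (p ^ e - 1)) + p ^ (e * Suc n) * i) * h) =
      s * \<psi> (s ^ (M + ?i) * (\<psi> ^^ n) h)" by (simp only: funpow.simps comp_apply IH)
    also have "s ^ (M + ?i) = (s ^ (M + i)) ^ (p ^ e)" by (simp only: pe power_mult)
    also have "s * \<psi> ((s ^ (M + i)) ^ (p ^ e) * (\<psi> ^^ n) h) = s * (s ^ (M + i) * \<psi> ((\<psi> ^^ n) h))"
      by (simp only: p_inv_linearD(2)[OF lin])
    finally show ?thesis by simp
  qed
  then show ?case by blast
qed

section \<open>Twisted Cartier algebras and log discrepancies over an affine open set\<close>

locale cartier_piece = affine_piece T \<O> U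
  for T :: "'a topology" and \<O> :: "'a set \<Rightarrow> 'k::field set" and U +
  fixes p :: nat and \<D> :: "nat \<Rightarrow> 'a set \<Rightarrow> ('k \<Rightarrow> 'k) set" and \<aa> :: "nat \<Rightarrow> 'a set \<Rightarrow> 'k set"
    and t :: real
  assumes p: "2 \<le> p" and separated: "separated_scheme T \<O>"
    and cartier: "cartier_subalgebra p T \<O> \<D>" and regular: "strongly_F_regular T \<O> \<D>"
    and graded: "graded_sequence_of_ideals T \<O> \<aa>" and t: "t \<ge> 0"
begin

abbreviation twisted where
  "twisted m \<equiv> twisted_cartier_subalgebra p T \<O> \<D> (\<aa> m) (t / real m)"

abbreviation ideal_pow where
  "ideal_pow m V k \<equiv> \<aa> m V [^]\<^bsub>ideals_set (subring_of_type (\<O> V))\<^esub> (k::nat)"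

abbreviation twist_exponent where
  "twist_exponent m e \<equiv> nat \<lceil>(t / real m) * (real p ^ e - 1)\<rceil>"

lemma cartier_linear: "nonempty_open T V \<Longrightarrow> \<phi> \<in> \<D> e V \<Longrightarrow> p_inv_linear p e \<phi>"
proof -
  assume "nonempty_open T V" "\<phi> \<in> \<D> e V"
  moreover have "\<forall>e U. nonempty_open T U \<longrightarrow> \<D> e U \<subseteq> cartier_algebra p T \<O> e U"
    using cartier unfolding cartier_subalgebra_def by blast
  ultimately have "\<phi> \<in> cartier_algebra p T \<O> e V" by blast
  then show ?thesis by (simp add: cartier_algebra_def)
qed

lemma cartier_scale:
  assumes V: "nonempty_open T V" and "f \<in> \<O> V" "\<phi> \<in> \<D> e V"
  shows "(\<lambda>g. f * \<phi> g) \<in> \<D> e V"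
proof -
  have "(\<lambda>g. f * g) \<in> \<D> 0 V" using cartier assms by (auto simp: cartier_subalgebra_def)
  then have "(\<lambda>g. f * g) \<circ> \<phi> \<in> \<D> (0 + e) V"
    using cartier assms unfolding cartier_subalgebra_def by blast
  then show ?thesis by (simp add: comp_def)
qed

lemma cartier_sheaf: "subsheaf_of_constant T (\<D> e)" "quasi_coherent T \<O> (\<lambda>c \<psi> g. c * \<psi> g) (\<D> e)"
  using cartier by (auto simp: cartier_subalgebra_def)

lemma ideal_sheaf:
  assumes "m \<ge> 1"
  shows "subsheaf_of_constant T (\<aa> m)" "quasi_coherent T \<O> (*) (\<aa> m)"
    "\<And>V. nonempty_open T V \<Longrightarrow> ideal (\<aa> m V) (subring_of_type (\<O> V))"
  using graded assms
  by (auto simp: graded_sequence_of_ideals_def coherent_ideal_sheaf_def ideal_sheaf_def)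

text \<open>A section is a sum of twisted maps only locally, but it is a single map on the function
  field, so one neighbourhood of one point decides.\<close>

lemma twisted_linear:
  assumes "nonempty_open T V" "\<psi> \<in> twisted m e V"
  shows "p_inv_linear p e \<psi>"
proof -
  obtain x where "x \<in> V" using assms by (auto simp: nonempty_open_def)
  then obtain V' n \<phi> a where "openin T V'" "x \<in> V'" and \<phi>: "\<And>i. i < (n::nat) \<Longrightarrow> \<phi> i \<in> \<D> e V'"
    and \<psi>: "\<psi> = (\<lambda>g. \<Sum>i<n. \<phi> i (a i * g))"
    using assms(2) unfolding twisted_cartier_subalgebra_def by blast
  then have "nonempty_open T V'" by (auto simp: nonempty_open_def)
  then show ?thesis unfolding \<psi> by (auto intro!: p_inv_linear_twisted_sum cartier_linear[OF _ \<phi>])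
qed

lemma twistedI:
  assumes "\<And>i. i < (n::nat) \<Longrightarrow> \<phi> i \<in> \<D> e U" "\<And>i. i < n \<Longrightarrow> a i \<in> ideal_pow m U (twist_exponent m e)"
  shows "(\<lambda>g. \<Sum>i<n. \<phi> i (a i * g)) \<in> twisted m e U"
  unfolding twisted_cartier_subalgebra_def mem_Collect_eq
  by (intro ballI exI[of _ U] conjI exI[of _ n] exI[of _ \<phi>] exI[of _ a] allI impI openin)
     (use assms in auto)

text \<open>Log discrepancies involve germs at the center of one valuation, whereas the limit
  argument compares valuations with different centers. Multiplication by a unit at \<open>x\<close>
  turns a germ into a section over \<open>U\<close>, which applies to all of them.\<close>

lemma twisted_clear_denominators:
  assumes m: "m \<ge> 1" and x: "x \<in> U" and \<psi>: "\<psi> \<in> stalk T (twisted m e) x"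
  shows "\<exists>s\<in>R. s \<notin> prime_at x \<and> (\<lambda>g. s * \<psi> g) \<in> twisted m e U"
proof -
  let ?k = "twist_exponent m e"
  obtain V0 where "openin T V0" "x \<in> V0" "\<psi> \<in> twisted m e V0" using \<psi> by (auto simp: stalk_def)
  then obtain V n \<phi> a where V: "openin T V" "x \<in> V"
    and \<phi>: "\<And>i. i < (n::nat) \<Longrightarrow> \<phi> i \<in> \<D> e V" and a: "\<And>i. i < n \<Longrightarrow> a i \<in> ideal_pow m V ?k"
    and \<psi>: "\<psi> = (\<lambda>g. \<Sum>i<n. \<phi> i (a i * g))"
    unfolding twisted_cartier_subalgebra_def by blast
  obtain q where q: "q \<in> R" "q \<notin> prime_at x" "q \<noteq> 0" "x \<in> D q" "D q \<subseteq> V"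
    by (rule basis[OF V x])
  have ne: "nonempty_open T V" "nonempty_open T (D q)"
    using V D_nonempty_open[OF q(1,3)] by (auto simp: nonempty_open_def)
  have I: "ideal (\<aa> m U) (subring_of_type R)" by (rule ideal_sheaf(3)[OF m nonempty_open])
  have "\<exists>N r. r \<in> \<D> e U \<and> (\<forall>g. q ^ N * \<phi> i g = r g)" if "i < n" for i
  proof -
    have "\<phi> i \<in> \<D> e (D q)" using subsheaf_mono[OF cartier_sheaf(1) ne q(5)] \<phi>[OF that] by blast
    also have "\<D> e (D q) = {\<lambda>g. inverse (q ^ N) * r g | r N. r \<in> \<D> e U}"
      using cartier_sheaf(2)[of e] affine q(1,3) by (simp add: quasi_coherent_def)
    finally obtain r N where "r \<in> \<D> e U" "\<phi> i = (\<lambda>g. inverse (q ^ N) * r g)" by auto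
    then show ?thesis using q(3) by (intro exI[of _ N] exI[of _ r]) simp
  qed
  then obtain L r where r: "\<And>i. i < n \<Longrightarrow> r i \<in> \<D> e U" "\<And>i g. i < n \<Longrightarrow> q ^ L i * \<phi> i g = r i g"
    by metis
  have "\<exists>N. q ^ N * a i \<in> ideal_pow m U ?k" if "i < n" for i
  proof (rule ideal_pow_clear_denominators[OF subring I q(1)])
    show "a i \<in> ideal_pow m (D q) ?k"
      using a[OF that] ideal_pow_mono[OF subsheaf_mono[OF sheaf ne q(5)]
          subsheaf_mono[OF ideal_sheaf(1)[OF m] ne q(5)]] by blast
    show "\<exists>N. q ^ N * z \<in> R" if "z \<in> \<O> (D q)" for z
    proof -
      obtain g N where "g \<in> R" "z = g / q ^ N" using \<open>z \<in> \<O> (D q)\<close> basic_sections[OF q(1,3)] by auto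
      then have "q ^ N * z \<in> R" using q(3) by simp
      then show ?thesis by blast
    qed
    show "\<exists>N. q ^ N * z \<in> \<aa> m U" if "z \<in> \<aa> m (D q)" for z
    proof -
      have "\<aa> m (D q) = {inverse (q ^ N) * g | g N. g \<in> \<aa> m U}"
        using ideal_sheaf(2)[OF m] affine q(1,3) by (simp add: quasi_coherent_def)
      then obtain g N where "g \<in> \<aa> m U" "z = inverse (q ^ N) * g" using \<open>z \<in> \<aa> m (D q)\<close> by auto
      then have "q ^ N * z \<in> \<aa> m U" using q(3) by (simp flip: mult.assoc)
      then show ?thesis by blast
    qed
  qed
  then obtain M where M: "\<And>i. i < n \<Longrightarrow> q ^ M i * a i \<in> ideal_pow m U ?k" by metis
  \<comment> \<open>A common bound for the finitely many exponents \<open>L i\<close> and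
    \<open>M i\<close>.\<close>
  define N where "N = (\<Sum>i<n. L i + M i)"
  have N: "L i \<le> N" "M i \<le> N" if "i < n" for i
    using member_le_sum[of i "{..<n}" "\<lambda>i. L i + M i"] that by (auto simp: N_def)
  have Np: "N \<le> N * p ^ e" using p by simp
  \<comment> \<open>One factor \<open>q ^ N\<close> stays outside and clears the denominators of the
    \<open>\<phi> i\<close>. The other enters \<open>\<phi> i\<close> as
    \<open>q ^ (N * p ^ e)\<close> and clears those of the \<open>a i\<close>.\<close>
  have "(\<lambda>g. q ^ (N + N) * \<psi> g) = (\<lambda>g. \<Sum>i<n. (q ^ (N - L i) * r i ((q ^ (N * p ^ e - M i) * (q ^ M i * a i)) * g)))"
  proof
    fix g
    have "q ^ (N + N) * \<phi> i (a i * g) = q ^ (N - L i) * r i ((q ^ (N * p ^ e - M i) * (q ^ M i * a i)) * g)"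
      if i: "i < n" for i
    proof -
      have 1: "q ^ (N - L i) * q ^ L i = q ^ N" using N[OF i] by (simp flip: power_add)
      have "M i \<le> N * p ^ e" using N(2)[OF i] Np by (rule le_trans)
      then have "q ^ (N * p ^ e - M i) * q ^ M i = q ^ (N * p ^ e)"
        by (simp flip: power_add)
      then have 2: "(q ^ (N * p ^ e - M i) * (q ^ M i * a i)) * g = (q ^ N) ^ (p ^ e) * (a i * g)"
        by (simp add: power_mult flip: mult.assoc)
      have "q ^ (N - L i) * r i ((q ^ N) ^ (p ^ e) * (a i * g)) =
          q ^ (N - L i) * (q ^ L i * \<phi> i ((q ^ N) ^ (p ^ e) * (a i * g)))" using r(2)[OF i] by simp
      also have "\<dots> = (q ^ (N - L i) * q ^ L i) * \<phi> i ((q ^ N) ^ (p ^ e) * (a i * g))"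
        by (simp add: mult.assoc)
      also have "\<dots> = q ^ N * (q ^ N * \<phi> i (a i * g))"
        by (simp only: 1 p_inv_linearD(2)[OF cartier_linear[OF ne(1) \<phi>[OF i]]])
      finally show ?thesis unfolding 2 by (simp add: power_add mult.assoc)
    qed
    then show "q ^ (N + N) * \<psi> g = (\<Sum>i<n. (q ^ (N - L i) * r i ((q ^ (N * p ^ e - M i) * (q ^ M i * a i)) * g)))"
      by (simp add: \<psi> sum_distrib_left)
  qed
  also have "\<dots> \<in> twisted m e U"
  proof (rule twistedI[where \<phi> = "\<lambda>i g. q ^ (N - L i) * r i g"])
    show "(\<lambda>g. q ^ (N - L i) * r i g) \<in> \<D> e U" if "i < n" for i
      by (rule cartier_scale[OF nonempty_open ring(6)[OF q(1)] r(1)[OF that]])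
    show "q ^ (N * p ^ e - M i) * (q ^ M i * a i) \<in> ideal_pow m U ?k" if "i < n" for i
      by (rule ideal_facts(4)[OF ideal_pow_ideal[OF subring I] ring(6)[OF q(1)] M[OF that]])
  qed
  finally show ?thesis
    using ring(6)[OF q(1)] power_prime_at[OF x q(1,2)] by blast
qed

text \<open>Strong F-regularity gives a germ sending \<open>h\<close> to 1. Clearing its denominator
  \<open>q ^ n\<close> yields a map over \<open>U\<close> that sends \<open>h\<close> to
  \<open>q ^ n\<close>, which is a unit at \<open>x\<close>.\<close>

lemma splitting_over_piece:
  assumes x: "x \<in> U" and h: "h \<in> R" "h \<noteq> 0"
  shows "\<exists>e\<ge>1. \<exists>\<phi>\<in>\<D> e U. \<phi> h \<in> R \<and> \<phi> h \<notin> prime_at x"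
proof -
  have "h \<in> stalk T \<O> x - {0}" using sections_subset_stalk[OF x, of \<O>] h by auto
  then obtain e \<psi> where e: "e \<ge> 1" "\<psi> \<in> stalk T (\<D> e) x" "\<psi> h = 1"
    using regular subset_topspace[OF x] unfolding strongly_F_regular_def by blast
  obtain q n r where q: "q \<in> R" "q \<notin> prime_at x" "q \<noteq> 0" and r: "r \<in> \<D> e U"
    and \<psi>: "\<psi> = (\<lambda>g. inverse (q ^ n) * r g)"
    by (rule stalk_quasi_coherent[OF cartier_sheaf x e(2)])
  have "r h = q ^ n" using e(3) q(3) by (simp add: \<psi> field_simps)
  then show ?thesis using e(1) r ring(6)[OF q(1)] power_prime_at[OF x q(1,2)] by metis
qed

lemma twist_by_power:
  assumes "\<phi> \<in> \<D> e U" "c \<in> \<aa> 1 U"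
  shows "(\<lambda>g. \<phi> (c ^ twist_exponent 1 e * g)) \<in> twisted 1 e U"
  using twistedI[where n = 1 and \<phi> = "\<lambda>_. \<phi>" and a = "\<lambda>_. c ^ twist_exponent 1 e" and m = 1]
    power_mem_ideal_pow[OF subring assms(2)] assms(1) by simp

text \<open>A nonzero section exists over some open set, which meets \<open>U\<close> by
  irreducibility; quasi-coherence then clears the denominator of its germ.\<close>

lemma nonzero_section: "\<exists>c\<in>\<aa> 1 U. c \<noteq> 0"
proof -
  have "\<forall>m\<ge>1. \<exists>V. nonempty_open T V \<and> \<not> \<aa> m V \<subseteq> {0}"
    using graded unfolding graded_sequence_of_ideals_def by blast
  then obtain V where V: "nonempty_open T V" "\<not> \<aa> 1 V \<subseteq> {0}" by (metis order_refl)
  then obtain d where d: "d \<in> \<aa> 1 V" "d \<noteq> 0" by blast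
  have "U \<inter> V \<noteq> {}" using irreducible nonempty_open V(1) by (auto simp: irreducible_space_def)
  then obtain x where x: "x \<in> U" "x \<in> V" by blast
  then have "d \<in> stalk T (\<aa> 1) x" using d V(1) by (intro stalkI[of T V]) (auto simp: nonempty_open_def)
  have 1: "(1::nat) \<ge> 1" by simp
  obtain q n r where q: "q \<in> R" "q \<notin> prime_at x" "q \<noteq> 0" and r: "r \<in> \<aa> 1 U" "d = inverse (q ^ n) * r"
    by (rule stalk_quasi_coherent[OF ideal_sheaf(1,2)[OF 1] x(1) \<open>d \<in> stalk T (\<aa> 1) x\<close>])
  then show ?thesis using d by auto
qed

text \<open>The suprema run over nonzero elements and nonzero maps;
  \<open>(\<psi> ^^ n) h \<noteq> 0\<close> guarantees both.\<close>

lemma E_quot_le_log_discrepancy: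
  assumes v: "v \<in> Val T \<O> U" and \<psi>: "\<psi> \<in> twisted m e U" and "m \<ge> 1" "e \<ge> 1" "n \<ge> 1" "(\<psi> ^^ n) h \<noteq> 0"
  shows "E_quot p (e * n) h (\<psi> ^^ n) v \<le> log_discrepancy_graded p T \<O> v \<D> \<aa> t"
proof -
  obtain x where x: "is_valuation v" "x \<in> U" "centered_at T \<O> v x" using v by (auto simp: Val_def)
  have c: "center_of T \<O> v = x" by (rule center_of_eq[OF separated x(1,3)])
  have st: "\<psi> \<in> stalk T (twisted m e) x" using \<psi> sections_subset_stalk[OF x(2), of "twisted m e"] by blast
  have lin: "p_inv_linear p e \<psi>" by (rule twisted_linear[OF nonempty_open \<psi>])
  have h: "h \<noteq> 0"
  proof
    assume "h = 0"
    moreover have "(\<psi> ^^ n) 0 = 0" by (induction n) (use p_inv_linearD(3)[OF lin] in auto)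
    ultimately show False using assms by simp
  qed
  have "\<psi> \<noteq> (\<lambda>_. 0)"
  proof
    assume "\<psi> = (\<lambda>_. 0)"
    then have "(\<psi> ^^ n) h = 0" using \<open>n \<ge> 1\<close> by (cases n) auto
    then show False using assms by simp
  qed
  then show ?thesis
    unfolding log_discrepancy_graded_def log_discrepancy_def log_discrepancy_map_def c
    by (intro SUP_upper2[of m] SUP_upper2[of e] SUP_upper2[of \<psi>] SUP_upper2[of h] SUP_upper2[of n])
       (use assms st h in auto)
qed

text \<open>The suprema yield a witness that is only a germ at the center. Multiplying it by a
  suitable \<open>s\<close> with \<open>v s = 0\<close> makes it a section over \<open>U\<close>,
  and replacing \<open>h\<close> by \<open>s ^ j * h\<close> keeps the quotient unchanged.\<close>

lemma less_log_discrepancyE: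
  assumes v: "v \<in> Val T \<O> U" and y: "y < log_discrepancy_graded p T \<O> v \<D> \<aa> t"
  obtains m e \<psi> n h where "m \<ge> 1" "e \<ge> 1" "n \<ge> 1" "h \<noteq> 0" "\<psi> \<in> twisted m e U"
    "y < E_quot p (e * n) h (\<psi> ^^ n) v"
proof -
  obtain x where x: "is_valuation v" "x \<in> U" "centered_at T \<O> v x" using v by (auto simp: Val_def)
  have c: "center_of T \<O> v = x" by (rule center_of_eq[OF separated x(1,3)])
  note vP = centered_atD[OF x(2,3)]
  obtain m e \<psi> h n where *: "m \<in> {1..}" "e \<in> {1..}" "\<psi> \<in> stalk T (twisted m e) x - {\<lambda>_. 0}"
    "h \<in> - {0}" "n \<in> {1..}" and y: "y < E_quot p (e * n) h (\<psi> ^^ n) v"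
    using y unfolding log_discrepancy_graded_def log_discrepancy_def log_discrepancy_map_def c less_SUP_iff
    by blast
  then have m: "m \<ge> 1" "e \<ge> 1" and \<psi>: "\<psi> \<in> stalk T (twisted m e) x" and h: "h \<noteq> 0" and n: "n \<ge> 1"
    by auto
  obtain s where s: "s \<in> R" "s \<notin> prime_at x" and s\<psi>: "(\<lambda>g. s * \<psi> g) \<in> twisted m e U"
    using twisted_clear_denominators[OF m(1) x(2) \<psi>] by blast
  have s0: "s \<noteq> 0" using s(2) prime_at_ideal(3)[OF x(2)] by auto
  have vpow: "v (s ^ i) = 0" for i
  proof (induction i)
    case (Suc i)
    have "v s = 0" using vP s by (auto simp: less_le)
    then show ?case using Suc is_valuationD(3)[OF x(1), of s "s ^ i"] by simp
  qed (use valuation_one[OF x(1)] in simp)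
  obtain V where V: "openin T V" "x \<in> V" "\<psi> \<in> twisted m e V" using \<psi> by (auto simp: stalk_def)
  have lin: "p_inv_linear p e \<psi>"
    by (rule twisted_linear[OF _ V(3)]) (use V in \<open>auto simp: nonempty_open_def\<close>)
  obtain M j where Mj: "\<forall>i h. ((\<lambda>g. s * \<psi> g) ^^ n) (s ^ (j + p ^ (e * n) * i) * h) = s ^ (M + i) * (\<psi> ^^ n) h"
    using iterate_scaled_map[OF lin, where s = s and n = n] p by auto
  have "((\<lambda>g. s * \<psi> g) ^^ n) (s ^ j * h) = s ^ M * (\<psi> ^^ n) h"
    using Mj[rule_format, of 0 h] by simp
  then have "E_quot p (e * n) (s ^ j * h) ((\<lambda>g. s * \<psi> g) ^^ n) v = E_quot p (e * n) h (\<psi> ^^ n) v"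
    by (simp add: E_quot_def is_valuationD(3)[OF x(1)] vpow)
  then show thesis using that[OF m n _ s\<psi>] y h s0 by (metis mult_eq_0_iff power_not_zero)
qed

end

section \<open>Limits of valuations\<close>

text \<open>A product of copies of the compact extended real line is compact by Tychonoff. The limit
  is taken along a filter finer than \<open>sequentially\<close>, since a product over an arbitrary
  index type need not be sequentially compact.\<close>

lemma pointwise_cluster_limit:
  fixes u :: "nat \<Rightarrow> 'b \<Rightarrow> ereal"
  obtains G w where "G \<noteq> bot" "G \<le> sequentially" "\<forall>x. ((\<lambda>n. u n x) \<longlongrightarrow> w x) G"
proof -
  have "compact_space (product_topology (\<lambda>_::'b. euclidean :: ereal topology) UNIV)"
    unfolding compact_space_product_topology
    using compact_UNIV[where 'a = ereal] by (simp add: compact_space_def)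
  then have "compact (UNIV :: ('b \<Rightarrow> ereal) set)"
    by (simp add: euclidean_product_topology compact_space_def)
  moreover have "filtermap u sequentially \<noteq> bot" by (simp add: filtermap_bot_iff)
  ultimately obtain w where w: "inf (nhds w) (filtermap u sequentially) \<noteq> bot"
    unfolding compact_filter by (metis UNIV_I always_eventually)
  \<comment> \<open>Pulls the neighbourhoods of \<open>w\<close> back to indices; it is nontrivial
    because \<open>w\<close> is a cluster point.\<close>
  define G where "G = inf (filtercomap u (nhds w)) sequentially"
  have "G \<noteq> bot"
  proof
    assume "G = bot"
    then have "eventually (\<lambda>_. False) G" by simp
    then obtain P Q where P: "eventually P (filtercomap u (nhds w))" and Q: "eventually Q sequentially"
      and PQ: "\<And>n. P n \<Longrightarrow> Q n \<Longrightarrow> False" unfolding G_def eventually_inf by blast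
    from P obtain P' where P': "eventually P' (nhds w)" "\<And>n. P' (u n) \<Longrightarrow> P n"
      unfolding eventually_filtercomap by blast
    have "eventually (\<lambda>y. \<not> P' y) (filtermap u sequentially)"
      unfolding eventually_filtermap by (rule eventually_mono[OF Q]) (use PQ P' in blast)
    then have "eventually (\<lambda>_. False) (inf (nhds w) (filtermap u sequentially))"
      unfolding eventually_inf using P'(1) by blast
    then show False using w by (simp add: eventually_False)
  qed
  moreover have "G \<le> sequentially" by (simp add: G_def)
  moreover have lim: "(u \<longlongrightarrow> w) G"
    unfolding G_def by (rule tendsto_mono[OF inf_le1 filterlim_filtercomap])
  have "((\<lambda>n. u n x) \<longlongrightarrow> w x) G" for x
    using continuous_on_tendsto_compose[OF continuous_on_product_coordinates[of x] lim] by simp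
  ultimately show thesis using that by blast
qed

lemma E_quot_real:
  assumes v: "is_valuation v" and "h \<noteq> 0" "\<theta> h \<noteq> 0" "e \<ge> 1" "2 \<le> (p::nat)"
  shows "E_quot p e h \<theta> v =
    ereal ((real_of_ereal (v h) - real p ^ e * real_of_ereal (v (\<theta> h))) / (real p ^ e - 1))"
proof -
  have "1 < real p ^ e" using assms by (intro one_less_power) auto
  moreover obtain a b where "v h = ereal a" "v (\<theta> h) = ereal b"
    using is_valuationD(2)[OF v] assms(2,3) by (metis ereal_real')
  ultimately show ?thesis by (simp add: E_quot_def)
qed

lemma valuation_real:
  assumes v: "is_valuation v"
  shows "\<And>x y. x \<noteq> 0 \<Longrightarrow> y \<noteq> 0 \<Longrightarrow> real_of_ereal (v (x * y)) = real_of_ereal (v x) + real_of_ereal (v y)"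
    "\<And>x y. x \<noteq> 0 \<Longrightarrow> y \<noteq> 0 \<Longrightarrow> x + y \<noteq> 0 \<Longrightarrow>
      min (real_of_ereal (v x)) (real_of_ereal (v y)) \<le> real_of_ereal (v (x + y))"
    "\<And>x. x \<noteq> 0 \<Longrightarrow> v x = ereal (real_of_ereal (v x))"
proof -
  show r: "\<And>x. x \<noteq> 0 \<Longrightarrow> v x = ereal (real_of_ereal (v x))"
    using is_valuationD(2)[OF v] by (simp add: ereal_real')
  show "real_of_ereal (v (x * y)) = real_of_ereal (v x) + real_of_ereal (v y)"
    if "x \<noteq> 0" "y \<noteq> 0" for x y
    using r[OF that(1)] r[OF that(2)] is_valuationD(3)[OF v, of x y]
    by (metis plus_ereal.simps(1) real_of_ereal.simps(1))
  show "min (real_of_ereal (v x)) (real_of_ereal (v y)) \<le> real_of_ereal (v (x + y))"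
    if "x \<noteq> 0" "y \<noteq> 0" "x + y \<noteq> 0" for x y
    using r[OF that(1)] r[OF that(2)] r[OF that(3)] is_valuationD(4)[OF v, of x y]
    by (metis ereal_less_eq(3) ereal_min)
qed

lemma valuation_of_real:
  fixes w :: "'k::field \<Rightarrow> real"
  assumes "\<And>x y. x \<noteq> 0 \<Longrightarrow> y \<noteq> 0 \<Longrightarrow> w (x * y) = w x + w y"
    "\<And>x y. x \<noteq> 0 \<Longrightarrow> y \<noteq> 0 \<Longrightarrow> x + y \<noteq> 0 \<Longrightarrow> min (w x) (w y) \<le> w (x + y)"
  shows "is_valuation (\<lambda>x. if x = 0 then \<infinity> else ereal (w x))"
proof -
  have "min (ereal (w x)) (ereal (w y)) \<le> ereal (w (x + y))" if "x \<noteq> 0" "y \<noteq> 0" "x + y \<noteq> 0" for x y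
    using assms(2)[OF that] by (auto simp: min_def split: if_splits)
  then show ?thesis unfolding is_valuation_def using assms(1) by auto
qed

section \<open>Clearing denominators in the multiplier ideal\<close>

context cartier_piece
begin

abbreviation "J \<equiv> multiplier_ideal p T \<O> \<D> \<aa> t"

text \<open>The single term \<open>E_quot\<close> bounds the log discrepancy from below. Clearing
  the denominator leaves a real inequality homogeneous in the valuation, which therefore survives
  rescaling.\<close>

lemma real_inequality:
  assumes v: "v \<in> Val T \<O> U" and g: "g \<noteq> 0" "v g + log_discrepancy_graded p T \<O> v \<D> \<aa> t \<le> 0"
    and \<psi>: "\<psi> \<in> twisted m e U" and m: "m \<ge> 1" "e \<ge> 1" "n \<ge> 1" and h: "h \<noteq> 0" "(\<psi> ^^ n) h \<noteq> 0"
  shows "real_of_ereal (v g) * (real p ^ (e * n) - 1) + real_of_ereal (v h)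
    \<le> real p ^ (e * n) * real_of_ereal (v ((\<psi> ^^ n) h))"
proof -
  have val: "is_valuation v" using v by (auto simp: Val_def)
  have en: "1 \<le> e * n" using m by simp
  have P: "1 < real p ^ (e * n)" using p en by (intro one_less_power) auto
  have "v g + E_quot p (e * n) h (\<psi> ^^ n) v \<le> v g + log_discrepancy_graded p T \<O> v \<D> \<aa> t"
    by (intro add_left_mono E_quot_le_log_discrepancy[OF v \<psi> m h(2)])
  also have "\<dots> \<le> 0" by (rule g)
  finally have "ereal (real_of_ereal (v g)) + ereal ((real_of_ereal (v h) - real p ^ (e * n) *
      real_of_ereal (v ((\<psi> ^^ n) h))) / (real p ^ (e * n) - 1)) \<le> 0"
    using E_quot_real[of v h "\<psi> ^^ n" "e * n" p, OF val h(1,2) en p] valuation_real(3)[OF val g(1)] by simp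
  then show ?thesis using P by (simp add: field_simps)
qed

lemma multiplier_ideal_denominators:
  assumes f: "f \<in> R" "f \<noteq> 0" and g: "g \<in> R" "g \<in> J (D f)"
  shows "\<exists>n. f ^ n * g \<in> J U"
proof (rule ccontr)
  assume "\<nexists>n. f ^ n * g \<in> J U"
  then have notin: "\<And>n. f ^ n * g \<notin> J U" by blast
  have g0: "g \<noteq> 0"
  proof
    assume "g = 0"
    \<comment> \<open>Holds whatever the log discrepancy is, because
      \<open>v 0 = \<infinity>\<close> and the sum of \<open>\<infinity>\<close> and
      \<open>-\<infinity>\<close> is \<open>\<infinity>\<close> in \<open>ereal\<close>.\<close>
    have "0 < v 0 + log_discrepancy_graded p T \<O> v \<D> \<aa> t" if "v \<in> Val_star T \<O> U" for v
      using that is_valuationD(1)[of v] by (auto simp: Val_star_def Val_def)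
    then have "f ^ 0 * g \<in> J U" using \<open>g = 0\<close> ring(1) by (auto simp: multiplier_ideal_def)
    then show False using notin by blast
  qed
  have "\<exists>v\<in>Val_star T \<O> U. v (f ^ n * g) + log_discrepancy_graded p T \<O> v \<D> \<aa> t \<le> 0" for n
    using notin[of n] ring(4,6) f(1) g(1) by (force simp: multiplier_ideal_def not_less)
  then obtain v where v: "\<And>n. v n \<in> Val_star T \<O> U"
    and v_le: "\<And>n. v n (f ^ n * g) + log_discrepancy_graded p T \<O> (v n) \<D> \<aa> t \<le> 0" by metis
  have vU: "v n \<in> Val T \<O> U" for n using v[of n] by (simp add: Val_star_def)
  have val: "is_valuation (v n)" for n using vU[of n] by (auto simp: Val_def)
  have v_ge: "v n r \<ge> 0" if "r \<in> R" for n r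
    using vU[of n] centered_atD(1)[of _ "v n" r] that by (auto simp: Val_def)
  define V where "V n z = real_of_ereal (v n z)" for n z
  have V_mult: "V n (z * y) = V n z + V n y" if "z \<noteq> 0" "y \<noteq> 0" for n z y
    using valuation_real(1)[OF val that] by (simp add: V_def)
  have V_add: "min (V n z) (V n y) \<le> V n (z + y)" if "z \<noteq> 0" "y \<noteq> 0" "z + y \<noteq> 0" for n z y
    using valuation_real(2)[OF val that] by (simp add: V_def)
  have V_pos: "0 \<le> V n r" if "r \<in> R" for n r
    using v_ge[OF that, of n] by (cases "v n r") (auto simp: V_def)
  \<comment> \<open>If \<open>v n f = 0\<close>, then \<open>v n\<close> is centered on
    \<open>D f\<close>, where membership of \<open>g\<close> in \<open>J (D f)\<close> contradicts
    the choice of \<open>v n\<close>, as the factor \<open>f ^ n\<close> has value 0.\<close>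
  have V_f: "0 < V n f" for n
  proof (rule ccontr)
    assume "\<not> 0 < V n f"
    then have "v n f = 0" using valuation_real(3)[OF val f(2), of n] V_pos[OF f(1), of n] by (simp add: V_def)
    obtain x where x: "x \<in> U" "centered_at T \<O> (v n) x" using vU[of n] by (auto simp: Val_def)
    then have "x \<in> D f" using centered_atD(2)[OF x] \<open>v n f = 0\<close> mem_D[OF f(1)] by auto
    then have "v n \<in> Val_star T \<O> (D f)" using v[of n] x val by (auto simp: Val_star_def Val_def)
    then have "v n g + log_discrepancy_graded p T \<O> (v n) \<D> \<aa> t > 0"
      using g(2) by (simp add: multiplier_ideal_def)
    moreover have "v n (f ^ k) = 0" for k
      by (induction k) (use valuation_one[OF val] is_valuationD(3)[OF val] \<open>v n f = 0\<close> in auto)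
    ultimately show False using v_le[of n] is_valuationD(3)[OF val, of n "f ^ n" g] by simp
  qed
  obtain c where c: "c \<in> \<aa> 1 U" "c \<noteq> 0" using nonzero_section by blast
  have cR: "c \<in> R" using ideal_facts(1)[OF ideal_sheaf(3)[OF _ nonempty_open, of 1]] c by auto
  \<comment> \<open>The factor \<open>f\<close> makes \<open>\<Lambda> n\<close> positive. The
    factor \<open>c\<close> bounds \<open>u n c\<close> by 1 and keeps the limit nontrivial, since
    \<open>f\<close> itself will get the value 0.\<close>
  define \<Lambda> where "\<Lambda> n = V n (c * f)" for n
  have \<Lambda>: "0 < \<Lambda> n" for n
    using V_f[of n] V_pos[OF cR, of n] V_mult[OF c(2) f(2), of n] by (simp add: \<Lambda>_def)
  define u where "u n z = V n z / \<Lambda> n" for n z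
  have u_mult: "u n (z * y) = u n z + u n y" if "z \<noteq> 0" "y \<noteq> 0" for n z y
    using V_mult[OF that] by (simp add: u_def add_divide_distrib)
  have u_add: "min (u n z) (u n y) \<le> u n (z + y)" if "z \<noteq> 0" "y \<noteq> 0" "z + y \<noteq> 0" for n z y
    using V_add[OF that, of n] \<Lambda>[of n] by (auto simp: u_def min_def divide_le_cancel split: if_splits)
  have u_pos: "0 \<le> u n r" if "r \<in> R" for n r
    using V_pos[OF that, of n] \<Lambda>[of n] by (simp add: u_def)
  have u_1: "u n 1 = 0" for n using u_mult[of 1 1 n] by simp
  have u_pow: "u n (z ^ k) = real k * u n z" if "z \<noteq> 0" for n z k
    by (induction k) (use that u_1 u_mult in \<open>auto simp: algebra_simps\<close>)
  have u_cf: "u n (c * f) = 1" for n using \<Lambda>[of n] by (simp add: u_def \<Lambda>_def)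
  have u_c: "u n c \<le> 1" for n using u_cf[of n] u_mult[OF c(2) f(2), of n] u_pos[OF f(1), of n] by simp
  have key: "(real n * u n f + u n g) * (real p ^ (e * k) - 1) + u n h \<le> real p ^ (e * k) * u n ((\<psi> ^^ k) h)"
    if "\<psi> \<in> twisted m e U" "m \<ge> 1" "e \<ge> 1" "k \<ge> 1" "h \<noteq> 0" "(\<psi> ^^ k) h \<noteq> 0" for n m e k \<psi> h
  proof -
    have "V n (f ^ n * g) * (real p ^ (e * k) - 1) + V n h \<le> real p ^ (e * k) * V n ((\<psi> ^^ k) h)"
      unfolding V_def by (rule real_inequality[OF vU _ v_le that]) (use f g0 in simp)
    then have "u n (f ^ n * g) * (real p ^ (e * k) - 1) + u n h \<le> real p ^ (e * k) * u n ((\<psi> ^^ k) h)"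
      using \<Lambda>[of n] by (simp add: u_def divide_simps)
    moreover have "u n (f ^ n * g) = real n * u n f + u n g" using f g0 by (simp add: u_mult u_pow)
    ultimately show ?thesis by simp
  qed
  obtain G w where G: "G \<noteq> bot" "G \<le> sequentially" and w: "\<forall>z. ((\<lambda>n. ereal (u n z)) \<longlongrightarrow> w z) G"
    by (rule pointwise_cluster_limit)
  have w_pos: "0 \<le> w r" if "r \<in> R" for r
    using w[rule_format, of r] by (rule tendsto_lowerbound) (use G(1) u_pos[OF that] in auto)
  have w_unique: "w z = l" if "((\<lambda>n. ereal (u n z)) \<longlongrightarrow> l) G" for z l
    using tendsto_unique[OF G(1) w[rule_format, of z] that] .
  \<comment> \<open>Restricted to \<open>R\<close>, where the limits are nonnegative and no
    difference of infinities can occur.\<close>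
  have w_mult: "w (r * s) = w r + w s" if "r \<in> R" "s \<in> R" "r \<noteq> 0" "s \<noteq> 0" for r s
  proof (rule w_unique)
    have "((\<lambda>n. ereal (u n r) + ereal (u n s)) \<longlongrightarrow> w r + w s) G"
      using w_pos[OF that(1)] w_pos[OF that(2)] w by (intro tendsto_add_ereal_nonneg) auto
    then show "((\<lambda>n. ereal (u n (r * s))) \<longlongrightarrow> w r + w s) G" using that by (simp add: u_mult)
  qed
  have w_add: "min (w r) (w s) \<le> w (r + s)" if "r \<noteq> 0" "s \<noteq> 0" "r + s \<noteq> 0" for r s
  proof (rule tendsto_le[OF G(1)])
    show "((\<lambda>n. ereal (u n (r + s))) \<longlongrightarrow> w (r + s)) G" using w by blast
    show "((\<lambda>n. min (ereal (u n r)) (ereal (u n s))) \<longlongrightarrow> min (w r) (w s)) G"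
      using w by (intro tendsto_min) auto
    show "eventually (\<lambda>n. min (ereal (u n r)) (ereal (u n s)) \<le> ereal (u n (r + s))) G"
      by (intro always_eventually allI) (use u_add[OF that] in \<open>simp flip: ereal_min\<close>)
  qed
  \<comment> \<open>Zero is included by hand: \<open>real_of_ereal \<infinity> = 0\<close> makes
    every \<open>u n 0\<close>, and so \<open>w 0\<close>, equal to 0.\<close>
  define P where "P = {r \<in> R. r = 0 \<or> 0 < w r}"
  have "primeideal P (subring_of_type R)"
    unfolding primeideal_subring_iff[OF subring] ideal_subring_iff[OF subring]
  proof (intro conjI ballI impI)
    have "w 1 = 0" by (rule w_unique) (simp add: u_1 zero_ereal_def)
    then have "1 \<notin> P" by (simp add: P_def)
    then show "P \<noteq> R" using ring(2) by blast
    show "a + b \<in> P" if "a \<in> P" "b \<in> P" for a b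
    proof (cases "a = 0 \<or> b = 0 \<or> a + b = 0")
      case False
      then have "0 < min (w a) (w b)" using that by (auto simp: P_def)
      then have "0 < w (a + b)" using w_add[of a b] False by (meson less_le_trans)
      then show ?thesis using that ring(3) by (auto simp: P_def)
    qed (use that ring(1) in \<open>auto simp: P_def\<close>)
    show "r * a \<in> P" if "a \<in> P" "r \<in> R" for a r
      using that w_mult[of r a] w_pos[of r] ring(4) by (cases "a = 0 \<or> r = 0") (auto simp: P_def add_nonneg_pos)
    show "a \<in> P \<or> b \<in> P" if "a * b \<in> P" "a \<in> R" "b \<in> R" for a b
      using that w_mult[of a b] w_pos[of a] w_pos[of b] by (auto simp: P_def less_le)
  qed (use ring in \<open>auto simp: P_def\<close>)
  then obtain x where x: "x \<in> U" "prime_at x = P" using prime_at_surj by blast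
  \<comment> \<open>\<open>C\<close> may depend on \<open>h\<close> but not on \<open>n\<close>.
    General \<open>h\<close> gives finiteness of \<open>w\<close>, and \<open>h = 1\<close> gives
    \<open>w f = 0\<close>.\<close>
  have bound: "\<exists>C. eventually (\<lambda>n. real n * u n f + u n h \<le> C) G" if h: "h \<in> R" "h \<noteq> 0" for h
  proof -
    obtain e \<phi> where e: "e \<ge> 1" and \<phi>: "\<phi> \<in> \<D> e U" "\<phi> h \<in> R" "\<phi> h \<notin> P"
      using splitting_over_piece[OF x(1) h] x(2) by auto
    let ?s = "\<phi> h"
    have s0: "?s \<noteq> 0" and "w ?s = 0" using \<phi> w_pos[of ?s] by (auto simp: P_def less_le)
    then have small: "eventually (\<lambda>n. u n ?s < 1) G"
      using order_tendstoD(2)[OF w[rule_format, of ?s], of 1] by (simp add: one_ereal_def)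
    \<comment> \<open>\<open>N p\<^sup>e\<close> is large enough for \<open>h'\<close> below to exist, with \<open>N\<close> independent of \<open>e\<close>.\<close>
    define N where "N = nat \<lceil>t\<rceil> + 1"
    let ?k = "twist_exponent 1 e"
    have P2: "2 \<le> real p ^ e"
    proof -
      have "p ^ 1 \<le> p ^ e" using e p by (intro power_increasing) auto
      then have "real 2 \<le> real (p ^ e)" using p by (intro of_nat_mono) simp
      then show ?thesis by simp
    qed
    have "t * (real p ^ e - 1) + 1 \<le> real (N * p ^ e)"
    proof -
      have "t \<le> real N - 1" using t by (simp add: N_def)
      then have "t * (real p ^ e - 1) \<le> (real N - 1) * (real p ^ e - 1)" using P2 by (intro mult_right_mono) auto
      also have "\<dots> + 1 \<le> real (N * p ^ e)" using P2 by (simp add: algebra_simps N_def)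
      finally show ?thesis by simp
    qed
    then have k: "?k \<le> N * p ^ e" by simp
    \<comment> \<open>The power of \<open>c\<close> completes the twist \<open>c ^ ?k\<close> to
      \<open>(c ^ N) ^ (p ^ e)\<close>, which leaves \<open>\<phi>\<close> as
      \<open>c ^ N\<close>.\<close>
    define h' where "h' = c ^ (N * p ^ e - ?k) * h"
    define \<psi> where "\<psi> = (\<lambda>y. \<phi> (c ^ ?k * y))"
    have \<psi>: "\<psi> \<in> twisted 1 e U" unfolding \<psi>_def by (rule twist_by_power[OF \<phi>(1) c(1)])
    have "c ^ ?k * h' = (c ^ N) ^ (p ^ e) * h"
      unfolding h'_def using k by (simp add: power_mult[symmetric] flip: mult.assoc power_add)
    then have \<psi>h': "\<psi> h' = c ^ N * ?s"
      by (simp only: \<psi>_def p_inv_linearD(2)[OF cartier_linear[OF nonempty_open \<phi>(1)]])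
    have h'0: "h' \<noteq> 0" "\<psi> h' \<noteq> 0" using c h s0 unfolding \<psi>h' by (auto simp: h'_def)
    have upper: "real n * u n f + u n h \<le> real p ^ e * (real N + 1)" if "u n ?s < 1" for n
    proof -
      have "(real n * u n f + u n g) * (real p ^ (e * 1) - 1) + u n h' \<le> real p ^ (e * 1) * u n ((\<psi> ^^ 1) h')"
        by (rule key[OF \<psi>]) (use e h'0 in auto)
      then have le: "(real n * u n f + u n g) * (real p ^ e - 1) + u n h' \<le> real p ^ e * (real N * u n c + u n ?s)"
        using c s0 by (simp add: \<psi>h' u_mult u_pow)
      have "u n h \<le> u n h'" using c h u_pos[OF cR, of n] by (simp add: h'_def u_mult u_pow)
      moreover have "real n * u n f + 0 \<le> (real n * u n f + u n g) * (real p ^ e - 1)"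
      proof -
        have "(real n * u n f + 0) * 1 \<le> (real n * u n f + u n g) * (real p ^ e - 1)"
          using P2 u_pos[OF f(1), of n] u_pos[OF g(1), of n] by (intro mult_mono add_mono) auto
        then show ?thesis by simp
      qed
      moreover have "real p ^ e * (real N * u n c + u n ?s) \<le> real p ^ e * (real N * 1 + 1)"
        using u_c[of n] that by (intro mult_left_mono add_mono) auto
      ultimately show ?thesis using le by simp
    qed
    show ?thesis by (rule exI[of _ "real p ^ e * (real N + 1)"]) (rule eventually_mono[OF small upper])
  qed
  have w_fin: "\<bar>w h\<bar> \<noteq> \<infinity>" if h: "h \<in> R" "h \<noteq> 0" for h
  proof -
    obtain C where C: "eventually (\<lambda>n. real n * u n f + u n h \<le> C) G" using bound[OF h] by blast
    have "eventually (\<lambda>n. ereal (u n h) \<le> ereal C) G"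
    proof (rule eventually_mono[OF C])
      show "ereal (u n h) \<le> ereal C" if "real n * u n f + u n h \<le> C" for n
      proof -
        have "0 \<le> real n * u n f" using u_pos[OF f(1), of n] by (intro mult_nonneg_nonneg) auto
        then show ?thesis using that by simp
      qed
    qed
    then have "w h \<le> ereal C" using w G(1) by (intro tendsto_upperbound[of "\<lambda>n. ereal (u n h)"]) auto
    then show ?thesis using w_pos[OF h(1)] by (cases "w h") auto
  qed
  \<comment> \<open>The factor \<open>n\<close> in the bound forces \<open>u n f\<close> below
    \<open>C / n\<close>.\<close>
  have w_f: "w f = 0"
  proof (rule w_unique)
    obtain C where C: "eventually (\<lambda>n. real n * u n f + u n 1 \<le> C) G" using bound[OF ring(2)] by auto
    have ev: "eventually (\<lambda>n. n \<ge> 1) G" using G(2) eventually_ge_at_top filter_leD by blast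
    have "((\<lambda>n. C / real n) \<longlongrightarrow> 0) G" using G(2) lim_const_over_n tendsto_mono by blast
    moreover have "eventually (\<lambda>n. u n f \<le> C / real n) G"
      using C ev by eventually_elim (simp add: u_1 field_simps)
    ultimately have "((\<lambda>n. u n f) \<longlongrightarrow> 0) G"
      by (intro tendsto_sandwich[of "\<lambda>_. 0" "\<lambda>n. u n f" G "\<lambda>n. C / real n" 0])
         (use u_pos[OF f(1)] in auto)
    then show "((\<lambda>n. ereal (u n f)) \<longlongrightarrow> 0) G" by (simp add: zero_ereal_def)
  qed
  define W where "W z = real_of_ereal (w z)" for z
  have W_R: "((\<lambda>n. u n h) \<longlongrightarrow> W h) G" if "h \<in> R" "h \<noteq> 0" for h
  proof -
    have "w h = ereal (W h)" using w_fin[OF that] by (simp add: W_def ereal_real')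
    then show ?thesis using w[rule_format, of h] by (simp add: lim_ereal)
  qed
  \<comment> \<open>Off \<open>R\<close>, \<open>w\<close> is not yet known to be finite; writing
    \<open>z\<close> as a fraction exhibits its limit as a difference of two finite ones.\<close>
  have W: "((\<lambda>n. u n z) \<longlongrightarrow> W z) G" if "z \<noteq> 0" for z
  proof -
    obtain a b where ab: "a \<in> R" "b \<in> R" "b \<noteq> 0" "z = a / b" using fraction_field[of z] by blast
    then have a: "a \<noteq> 0" "a = z * b" using that by auto
    then have "u n z = u n a - u n b" for n using u_mult[OF that ab(3), of n] by simp
    then have lim: "((\<lambda>n. u n z) \<longlongrightarrow> W a - W b) G"
      using tendsto_diff[OF W_R[OF ab(1) a(1)] W_R[OF ab(2,3)]] by simp
    then have "w z = ereal (W a - W b)" by (intro w_unique) simp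
    then show ?thesis using lim by (simp add: W_def)
  qed
  have W_unique: "W z = l" if "z \<noteq> 0" "((\<lambda>n. u n z) \<longlongrightarrow> l) G" for z l
    using tendsto_unique[OF G(1) W[OF that(1)] that(2)] .
  \<comment> \<open>Restores the value \<open>\<infinity>\<close> at 0, which the passage to real
    numbers had replaced by 0.\<close>
  define w' where "w' = (\<lambda>z. if z = 0 then \<infinity> else ereal (W z))"
  have w'_val: "is_valuation w'"
    unfolding w'_def
  proof (rule valuation_of_real)
    fix y z :: 'k assume yz: "y \<noteq> 0" "z \<noteq> 0"
    show "W (y * z) = W y + W z"
      using yz tendsto_add[OF W[OF yz(1)] W[OF yz(2)]] by (intro W_unique) (auto simp: u_mult)
    show "min (W y) (W z) \<le> W (y + z)" if "y + z \<noteq> 0"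
      using u_add[OF yz that] by (intro tendsto_le[OF G(1) W[OF that] tendsto_min[OF W[OF yz(1)] W[OF yz(2)]]]) auto
  qed
  have w'_R: "w' r = (if r = 0 then \<infinity> else w r)" if "r \<in> R" for r
    using w_fin[OF that] by (auto simp: w'_def W_def ereal_real')
  have centered: "centered_at T \<O> w' x"
  proof (rule centered_atI[OF w'_val x(1)])
    show "0 \<le> w' r" if "r \<in> R" for r using w'_R[OF that] w_pos[OF that] by simp
    show "prime_at x = R \<inter> {r. 0 < w' r}" using w'_R by (auto simp: x(2) P_def split: if_splits)
  qed
  have "x \<in> D f" using w_f f x mem_D[OF f(1)] by (auto simp: P_def)
  moreover have "W (c * f) = 1" by (rule W_unique) (use c f u_cf in auto)
  then have "w' (c * f) \<noteq> trivial_valuation (c * f)" using c f by (simp add: w'_def trivial_valuation_def)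
  then have "w' \<noteq> trivial_valuation" by metis
  ultimately have "w' \<in> Val_star T \<O> (D f)"
    using w'_val centered by (auto simp: Val_star_def Val_def)
  then have "w' g + log_discrepancy_graded p T \<O> w' \<D> \<aa> t > 0"
    using g(2) by (simp add: multiplier_ideal_def)
  \<comment> \<open>With \<open>W g\<close> on the other side, the strict inequality against a
    supremum is witnessed by a single map over \<open>U\<close>, which can then be evaluated at
    every \<open>v n\<close>.\<close>
  then have "ereal (- W g) < log_discrepancy_graded p T \<O> w' \<D> \<aa> t"
    using g0 by (cases "log_discrepancy_graded p T \<O> w' \<D> \<aa> t") (auto simp: w'_def)
  moreover have "w' \<in> Val T \<O> U" using w'_val centered x(1) by (auto simp: Val_def)
  ultimately obtain m e \<psi> k h where m: "m \<ge> 1" "e \<ge> 1" "k \<ge> 1" "h \<noteq> 0" and \<psi>: "\<psi> \<in> twisted m e U"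
    and lt: "ereal (- W g) < E_quot p (e * k) h (\<psi> ^^ k) w'"
    by (elim less_log_discrepancyE[rotated]) blast
  have ek: "1 \<le> e * k" using m by simp
  have Q: "1 < real p ^ (e * k)" using p ek by (intro one_less_power) auto
  have \<psi>h: "(\<psi> ^^ k) h \<noteq> 0"
  proof
    assume "(\<psi> ^^ k) h = 0"
    then have "E_quot p (e * k) h (\<psi> ^^ k) w' = -\<infinity>" using m(4) Q p by (simp add: E_quot_def w'_def)
    then show False using lt by simp
  qed
  have "- W g < (W h - real p ^ (e * k) * W ((\<psi> ^^ k) h)) / (real p ^ (e * k) - 1)"
    using lt E_quot_real[of w' h "\<psi> ^^ k" "e * k" p, OF w'_val m(4) \<psi>h ek p] m(4) \<psi>h by (simp add: w'_def)
  then have "0 < W g * (real p ^ (e * k) - 1) + W h - real p ^ (e * k) * W ((\<psi> ^^ k) h)"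
    using Q by (simp add: field_simps)
  \<comment> \<open>The witnessing inequality is strict and involves only three nonzero elements, so
    it already holds for some \<open>u n\<close>. There it contradicts \<open>key\<close>, whose
    additional term in \<open>u n f\<close> is nonnegative.\<close>
  moreover have "((\<lambda>n. u n g * (real p ^ (e * k) - 1) + u n h - real p ^ (e * k) * u n ((\<psi> ^^ k) h)) \<longlongrightarrow>
      W g * (real p ^ (e * k) - 1) + W h - real p ^ (e * k) * W ((\<psi> ^^ k) h)) G"
    by (intro tendsto_intros W g0 m(4) \<psi>h)
  ultimately have "eventually (\<lambda>n. 0 < u n g * (real p ^ (e * k) - 1) + u n h - real p ^ (e * k) * u n ((\<psi> ^^ k) h)) G"
    using order_tendstoD(1) by blast
  then obtain n where "0 < u n g * (real p ^ (e * k) - 1) + u n h - real p ^ (e * k) * u n ((\<psi> ^^ k) h)"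
    using eventually_happens' G(1) by blast
  moreover have "0 \<le> real n * u n f * (real p ^ (e * k) - 1)" using u_pos[OF f(1), of n] Q by simp
  ultimately show False using key[OF \<psi> m(1-4) \<psi>h, of n] by (simp add: algebra_simps)
qed

end

section \<open>Coherence of the multiplier ideal\<close>

context int_scheme
begin

text \<open>Each valuation imposes a lower bound on \<open>v f\<close>. Sums respect it by the
  ultrametric inequality, and multiples because sections over \<open>V\<close> are germs at the
  center and so have nonnegative value.\<close>

lemma multiplier_ideal_ideal:
  assumes V: "nonempty_open T V"
  shows "ideal (multiplier_ideal p T \<O> \<D> \<aa> t V) (subring_of_type (\<O> V))"
  unfolding ideal_subring_iff[OF sections_subring[OF V]]
proof (intro conjI ballI)
  note ring = is_subringD[OF sections_subring[OF V]]
  let ?A = "\<lambda>v. log_discrepancy_graded p T \<O> v \<D> \<aa> t"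
  have val: "is_valuation v" if "v \<in> Val_star T \<O> V" for v
    using that by (auto simp: Val_star_def Val_def)
  show "multiplier_ideal p T \<O> \<D> \<aa> t V \<subseteq> \<O> V" by (auto simp: multiplier_ideal_def)
  have "0 < v 0 + ?A v" if "v \<in> Val_star T \<O> V" for v
    using is_valuationD(1)[OF val[OF that]] by simp
  then show "0 \<in> multiplier_ideal p T \<O> \<D> \<aa> t V" using ring(1) by (simp add: multiplier_ideal_def)
  fix a assume a: "a \<in> multiplier_ideal p T \<O> \<D> \<aa> t V"
  show "a + b \<in> multiplier_ideal p T \<O> \<D> \<aa> t V" if b: "b \<in> multiplier_ideal p T \<O> \<D> \<aa> t V" for b
  proof -
    have "0 < v (a + b) + ?A v" if v: "v \<in> Val_star T \<O> V" for v
    proof -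
      have "0 < min (v a) (v b) + ?A v"
        using a b v by (auto simp: multiplier_ideal_def min_def)
      also have "\<dots> \<le> v (a + b) + ?A v"
        by (intro add_right_mono is_valuationD(4)[OF val[OF v]])
      finally show ?thesis .
    qed
    then show ?thesis using a b ring(3) by (auto simp: multiplier_ideal_def)
  qed
  show "r * a \<in> multiplier_ideal p T \<O> \<D> \<aa> t V" if r: "r \<in> \<O> V" for r
  proof -
    have "0 < v (r * a) + ?A v" if v: "v \<in> Val_star T \<O> V" for v
    proof -
      obtain x where x: "x \<in> V" "centered_at T \<O> v x" using v by (auto simp: Val_star_def Val_def)
      then have "r \<in> stalk T \<O> x" using r V by (intro stalkI[of T V]) (auto simp: nonempty_open_def)
      then have "0 \<le> v r" using x(2) by (auto simp: centered_at_def)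
      have "0 < v a + ?A v" using a v by (simp add: multiplier_ideal_def)
      also have "\<dots> = 0 + v a + ?A v" by simp
      also have "\<dots> \<le> v r + v a + ?A v" using \<open>0 \<le> v r\<close> by (intro add_right_mono)
      finally show ?thesis using is_valuationD(3)[OF val[OF v], of r a] by simp
    qed
    then show ?thesis using a r ring(4) by (auto simp: multiplier_ideal_def)
  qed
qed

lemma multiplier_ideal_subsheaf: "subsheaf_of_constant T (multiplier_ideal p T \<O> \<D> \<aa> t)"
  unfolding subsheaf_of_constant_def
proof (intro allI impI)
  fix \<U> :: "'a set set" assume U: "\<U> \<noteq> {} \<and> (\<forall>V\<in>\<U>. nonempty_open T V)"
  then have "\<O> (\<Union>\<U>) = (\<Inter>V\<in>\<U>. \<O> V)" using sheaf unfolding subsheaf_of_constant_def by blast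
  moreover have "Val_star T \<O> (\<Union>\<U>) = (\<Union>V\<in>\<U>. Val_star T \<O> V)"
    by (auto simp: Val_star_def Val_def)
  ultimately show "multiplier_ideal p T \<O> \<D> \<aa> t (\<Union>\<U>) =
      (\<Inter>V\<in>\<U>. multiplier_ideal p T \<O> \<D> \<aa> t V)"
    using U by (auto simp: multiplier_ideal_def)
qed

end

lemma (in cartier_piece) multiplier_ideal_basic_open:
  assumes f: "f \<in> R" "f \<noteq> 0"
  shows "J (D f) = {inverse (f ^ n) * s | s n. s \<in> J U}"
proof (intro subset_antisym subsetI)
  have ne: "nonempty_open T (D f)" by (rule D_nonempty_open[OF f])
  note JD = multiplier_ideal_ideal[OF ne, unfolded ideal_subring_iff[OF sections_subring[OF ne]]]
  have closed: "r * s \<in> J (D f)" if "r \<in> \<O> (D f)" "s \<in> J (D f)" for r s using JD that by blast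
  show "g \<in> {inverse (f ^ n) * s | s n. s \<in> J U}" if g: "g \<in> J (D f)" for g
  proof -
    have "g \<in> \<O> (D f)" using g by (simp add: multiplier_ideal_def)
    then obtain g' k where g': "g' \<in> R" "g = g' / f ^ k" using basic_sections[OF f] by auto
    \<comment> \<open>Replaces \<open>g\<close> by its numerator, which lies in \<open>R\<close> as
      the denominator lemma requires and is still in \<open>J (D f)\<close>.\<close>
    have "f ^ k \<in> \<O> (D f)"
      using subsheaf_mono[OF sheaf nonempty_open ne D_subset] ring(6)[OF f(1)] by blast
    then have "f ^ k * g \<in> J (D f)" using g by (rule closed)
    then have "g' \<in> J (D f)" using g'(2) f(2) by simp
    then obtain n where "f ^ n * g' \<in> J U" using multiplier_ideal_denominators[OF f g'(1)] by blast
    moreover have "g = inverse (f ^ (n + k)) * (f ^ n * g')"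
      using f(2) g'(2) by (simp add: power_add field_simps)
    ultimately show ?thesis by blast
  qed
  fix g assume "g \<in> {inverse (f ^ n) * s | s n. s \<in> J U}"
  then obtain s n where s: "s \<in> J U" "g = inverse (f ^ n) * s" by blast
  have "1 / f ^ n \<in> \<O> (D f)" using basic_sections[OF f] ring(2) by blast
  moreover have "s \<in> J (D f)"
    using subsheaf_mono[OF multiplier_ideal_subsheaf nonempty_open ne D_subset] s(1) by blast
  ultimately show "g \<in> J (D f)" using closed[of "1 / f ^ n" s] s(2) by (simp add: inverse_eq_divide)
qed

theorem theorem7p7:
  fixes T :: "'a topology"
    and \<O> :: "'a set \<Rightarrow> 'k::field set"
    and \<D> :: "nat \<Rightarrow> 'a set \<Rightarrow> ('k \<Rightarrow> 'k) set"
    and \<aa> :: "nat \<Rightarrow> 'a set \<Rightarrow> 'k set"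
    and p :: nat
    and t :: real
  assumes "Factorial_Ring.prime p" and "CHAR('k) = p"
    and "integral_scheme T \<O>"
    and "separated_scheme T \<O>"
    and "noetherian_scheme T \<O>"
    and "F_finite p T \<O>"
    and "strongly_F_regular T \<O> (cartier_algebra p T \<O>)"
    and "cartier_subalgebra p T \<O> \<D>"
    and "strongly_F_regular T \<O> \<D>"
    and "graded_sequence_of_ideals T \<O> \<aa>"
    and "t \<ge> 0"
  shows "coherent_ideal_sheaf T \<O> (multiplier_ideal p T \<O> \<D> \<aa> t)"
proof -
  interpret int_scheme T \<O> by unfold_locales fact
  have "2 \<le> p" using assms(1) prime_ge_2_nat by blast
  then have piece: "cartier_piece T \<O> U p \<D> \<aa> t" if "affine_open T \<O> U" for U
    by unfold_locales (use assms that in auto)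
  have "quasi_coherent T \<O> (*) (multiplier_ideal p T \<O> \<D> \<aa> t)"
    unfolding quasi_coherent_def
  proof (intro allI impI)
    fix U f assume "affine_open T \<O> U \<and> f \<in> \<O> U - {0}"
    then show "multiplier_ideal p T \<O> \<D> \<aa> t (basic_open T \<O> U f) =
        {inverse (f ^ n) * s | s n. s \<in> multiplier_ideal p T \<O> \<D> \<aa> t U}"
      using cartier_piece.multiplier_ideal_basic_open[OF piece] by simp
  qed
  moreover have "\<exists>S. finite S \<and> S \<subseteq> multiplier_ideal p T \<O> \<D> \<aa> t U \<and>
      multiplier_ideal p T \<O> \<D> \<aa> t U = genideal (subring_of_type (\<O> U)) S"
    if U: "affine_open T \<O> U" for U
  proof -
    interpret affine_piece T \<O> U by unfold_locales (rule U)
    show ?thesis by (rule ideal_finitely_generated[OF assms(5) multiplier_ideal_ideal[OF nonempty_open]])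
  qed
  ultimately show ?thesis
    using multiplier_ideal_ideal multiplier_ideal_subsheaf
    by (simp add: coherent_ideal_sheaf_def ideal_sheaf_def)
qed

end
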